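(* Let $V = (V_x)_{x \in X}$ be a Borel field of Polish spaces. Assume that every $V_x$ is locally compact. Consider the family $C(V) = (C(V_x))_{x \in X}$ of spaces of continuous functions from $V_x$ to $\mathbb{C}$, where we equip each $C(V_x)$ with the compact-open topology, so that each $C(V_x)$ is a Polish space. There is a unique standard Borel structure on $C(V)$ such that the maps $\pi : C(V) \to X$ and $C(V) \times_\pi V \to \mathbb{C} : (F,v) \mapsto F(v)$ are Borel. In this way, $C(V)$ is a Borel field of Polish spaces. Addition $C(V)\times_\pi C(V)\to C(V)$, multiplication $C(V)\times_\pi C(V)\to C(V)$ and complex conjugation $C(V)\to C(V)$ are Borel maps.
   Context: Conventions. A standard Borel space is a measurable space isomorphic to a Borel subset of a Polish space. Product spaces carry the product $\sigma$-algebra and subsets the restricted $\sigma$-algebra. For a family of sets $V = (V_x)_{x\in X}$, the symbol $V$ also denotes the disjoint union of the $V_x$, and $\pi : V \to X$ is the map with $\pi(v) = x$ for $v \in V_x$. For two families over $X$, $V \times_\pi W = \{(v,w) \in V \times W \mid \pi(v)=\pi(w)\}$. A section is a map $\varphi : X \to V$ with $\varphi(x)\in V_x$ for all $x$. A sequence of Borel sections $\varphi_n : X \to V$ is dense if $\{\varphi_n(x) \mid n\in\mathbb{N}\}$ is dense in $V_x$ for every $x\in X$. A Borel field of Polish spaces consists of a standard Borel space $X$, a family $V=(V_x)_{x\in X}$ of Polish spaces and a standard Borel structure on $V$ such that: (1) $\pi : V\to X$ is Borel; (2) there is a Borel map $d : V\times_\pi V\to[0,+\infty)$ whose restriction to each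 $V_x\times V_x$ is a separable complete metric inducing the topology of $V_x$; (3) there is a dense sequence of Borel sections $X\to V$. *)

theory Defs
  imports "HOL-Analysis.Analysis"
begin

text \<open>
  A Borel structure on a set is given by a value of type \<open>'a measure\<close>; only its \<open>space\<close>
  and \<open>sets\<close> are used, and two structures are the same iff their \<open>sets\<close> agree.
\<close>

definition Polish_space :: "'a topology \<Rightarrow> bool" where
  "Polish_space T \<longleftrightarrow> separable_space T \<and> completely_metrizable_space T"

definition borel_of :: "'a topology \<Rightarrow> 'a measure" where
  "borel_of T = sigma (topspace T) {U. openin T U}"

text \<open>
  HOL cannot quantify over the type carrying the ambient Polish space. Polish spaces have at most
  the cardinality of the continuum, so up to homeomorphism their points are real numbers and
  it suffices to let \<open>P\<close> range over all Polish topologies on sets of reals (unrelated to the usual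
  topology); see \<open>Polish_space_real_copy\<close> below.
\<close>

definition standard_borel :: "'a measure \<Rightarrow> bool" where
  "standard_borel M \<longleftrightarrow>
    (\<exists>(P :: real topology) B f g.
        Polish_space P \<and> B \<in> sets (borel_of P) \<and>
        f \<in> measurable M (restrict_space (borel_of P) B) \<and>
        g \<in> measurable (restrict_space (borel_of P) B) M \<and>
        (\<forall>x\<in>space M. g (f x) = x) \<and>
        (\<forall>y\<in>B. f (g y) = y))"

lemma Polish_space_real_copy:
  fixes T :: "'a topology"
  assumes "Polish_space T"
  shows "\<exists>P :: real topology. Polish_space P \<and> T homeomorphic_space P"
proof -
  obtain M d where Md: "Metric_space M d" and T: "T = Metric_space.mtopology M d"
    using assms unfolding Polish_space_def completely_metrizable_space_def by blast
  interpret Metric_space M d by (rule Md)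
  have top: "topspace T = M" using T by simp
  obtain C where C: "countable C" "C \<subseteq> M" "T closure_of C = M"
    using assms top unfolding Polish_space_def separable_space_def by auto
  define e where "e = (\<lambda>x. {(to_nat_on C c, k) | c k. c \<in> C \<and> d x c < inverse (real (Suc k))})"
  have inj_e: "inj_on e M"
  proof (rule inj_onI, rule ccontr)
    fix x y assume xy: "x \<in> M" "y \<in> M" "e x = e y" "x \<noteq> y"
    then have "0 < d x y / 2" by simp
    then obtain k where k: "inverse (real (Suc k)) < d x y / 2" using reals_Archimedean by blast
    have "x \<in> T closure_of C" using C xy by simp
    then have "\<forall>r>0. \<exists>c\<in>C. c \<in> mball x r"
      unfolding T metric_closure_of by blast
    moreover have "0 < inverse (real (Suc k))" by simp
    ultimately obtain c where c: "c \<in> C" "c \<in> mball x (inverse (real (Suc k)))" by blast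
    then have c: "c \<in> C" "d x c < inverse (real (Suc k))" by (simp_all only: in_mball)
    then have "(to_nat_on C c, k) \<in> e y" using xy(3) unfolding e_def by blast
    then obtain c' where c': "c' \<in> C" "to_nat_on C c = to_nat_on C c'" "d y c' < inverse (real (Suc k))"
      unfolding e_def by auto
    then have "c' = c" using C(1) c(1) by simp
    then have "d y c < inverse (real (Suc k))" using c'(3) by simp
    moreover have "d x y \<le> d x c + d y c"
      using triangle[of x c y] xy c C commute[of c y] by auto
    ultimately show False using c k by linarith
  qed
  obtain h :: "(nat \<times> nat) set \<Rightarrow> real" where h: "inj h"
  proof -
    have "inj (image (prod_encode) :: (nat \<times> nat) set \<Rightarrow> nat set)"
      by (simp add: inj_image_eq_iff inj_on_def inj_prod_encode)
    moreover obtain g :: "nat set \<Rightarrow> real" where "inj g"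
      using nat_sets_eqpoll_reals eqpoll_def bij_betw_imp_inj_on by metis
    ultimately show ?thesis using that inj_compose by blast
  qed
  define f where "f = (\<lambda>x. h (e x))"
  have f: "inj_on f M" unfolding f_def using inj_e h by (auto simp: inj_on_def)
  define g where "g = inv_into M f"
  define P where "P = pullback_topology (f ` M) g T"
  have topP: "topspace P = f ` M"
    unfolding P_def topspace_pullback_topology top g_def using f by auto
  have "homeomorphic_maps T P f g"
    unfolding homeomorphic_maps_def
  proof (intro conjI ballI)
    show "continuous_map T P f"
      unfolding P_def
    proof (rule continuous_map_pullback')
      show "continuous_map T T (g \<circ> f)"
        by (rule continuous_map_eq[OF continuous_map_id]) (simp add: top g_def f)
    qed (auto simp: top)
    show "continuous_map P T g"
      using continuous_map_pullback[OF continuous_map_id, of "f ` M" g T] unfolding P_def by simp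
    show "\<And>x. x \<in> topspace T \<Longrightarrow> g (f x) = x" by (simp add: top g_def f)
    show "\<And>y. y \<in> topspace P \<Longrightarrow> f (g y) = y" by (simp add: topP g_def f_inv_into_f)
  qed
  then have hom: "T homeomorphic_space P" unfolding homeomorphic_space_def by blast
  then have "Polish_space P"
    using assms homeomorphic_separable_space homeomorphic_completely_metrizable_space
    unfolding Polish_space_def by blast
  with hom show ?thesis by blast
qed

definition disjoint_union :: "'x set \<Rightarrow> ('x \<Rightarrow> 'v topology) \<Rightarrow> ('x \<times> 'v) set" where
  "disjoint_union X V = (SIGMA x:X. topspace (V x))"

definition fibre_product ::
    "('x \<times> 'v) measure \<Rightarrow> ('x \<times> 'w) measure \<Rightarrow> (('x \<times> 'v) \<times> ('x \<times> 'w)) measure" where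
  "fibre_product M N = restrict_space (M \<Otimes>\<^sub>M N) {(v, w). fst v = fst w}"

text \<open>
  The family is \<open>(V x)\<close> for \<open>x \<in> space X\<close> and \<open>M\<close> is the Borel structure on its disjoint union, so that
  \<open>\<pi>\<close> is \<open>fst\<close>. \<open>Metric_space\<close> also demands nonnegativity and symmetry
  of \<open>d\<close> off the carrier; this is harmless because \<open>d\<close> may be taken to vanish outside the fibre
  product. The section \<open>x \<mapsto> (x, \<phi> n x)\<close> takes values in \<open>V x\<close> because of \<open>space M\<close>.
\<close>

definition Borel_field_of_Polish_spaces ::
    "'x measure \<Rightarrow> ('x \<Rightarrow> 'v topology) \<Rightarrow> ('x \<times> 'v) measure \<Rightarrow> bool" where
  "Borel_field_of_Polish_spaces X V M \<longleftrightarrow>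
    standard_borel X \<and>
    (\<forall>x\<in>space X. Polish_space (V x)) \<and>
    standard_borel M \<and> space M = disjoint_union (space X) V \<and>
    fst \<in> measurable M X \<and>
    (\<exists>d :: ('x \<times> 'v) \<times> ('x \<times> 'v) \<Rightarrow> real.
        d \<in> borel_measurable (fibre_product M M) \<and>
        (\<forall>x\<in>space X. let dx = (\<lambda>u w. d ((x, u), (x, w))) in
            Metric_space (topspace (V x)) dx \<and>
            Metric_space.mcomplete (topspace (V x)) dx \<and>
            Metric_space.mtopology (topspace (V x)) dx = V x)) \<and>
    (\<exists>\<phi> :: nat \<Rightarrow> 'x \<Rightarrow> 'v.
        (\<forall>n. (\<lambda>x. (x, \<phi> n x)) \<in> measurable X M) \<and>
        (\<forall>x\<in>space X. V x closure_of range (\<lambda>n. \<phi> n x) = topspace (V x)))"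

text \<open>
  Continuous functions on \<open>S\<close> are represented by functions that are \<open>undefined\<close> off \<open>topspace S\<close>,
  so that distinct representatives are distinct functions on \<open>topspace S\<close>.
\<close>

definition continuous_functions :: "'a topology \<Rightarrow> 'b topology \<Rightarrow> ('a \<Rightarrow> 'b) set" where
  "continuous_functions S T = {f \<in> extensional (topspace S). continuous_map S T f}"

definition compact_open_topology :: "'a topology \<Rightarrow> 'b topology \<Rightarrow> ('a \<Rightarrow> 'b) topology" where
  "compact_open_topology S T = topology_generated_by
     {{f \<in> continuous_functions S T. f ` K \<subseteq> U} | K U. compactin S K \<and> openin T U}"

lemma topspace_compact_open_topology:
  "topspace (compact_open_topology S T) = continuous_functions S T"
proof -
  have "compactin S {} \<and> openin T {}" by simp
  then have "{f \<in> continuous_functions S T. f ` {} \<subseteq> {}} \<in>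
      {{f \<in> continuous_functions S T. f ` K \<subseteq> U} | K U. compactin S K \<and> openin T U}" by blast
  then show ?thesis
    unfolding compact_open_topology_def topology_generated_by_topspace by fastforce
qed

abbreviation function_field :: "('x \<Rightarrow> 'v topology) \<Rightarrow> 'x \<Rightarrow> ('v \<Rightarrow> complex) topology" where
  "function_field V \<equiv> \<lambda>x. compact_open_topology (V x) euclidean"

definition evaluation_Borel_structure ::
    "'x measure \<Rightarrow> ('x \<Rightarrow> 'v topology) \<Rightarrow> ('x \<times> 'v) measure \<Rightarrow>
      ('x \<times> ('v \<Rightarrow> complex)) measure \<Rightarrow> bool" where
  "evaluation_Borel_structure X V M N \<longleftrightarrow>
    standard_borel N \<and> space N = disjoint_union (space X) (function_field V) \<and>
    fst \<in> measurable N X \<and>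
    (\<lambda>((x, F), (y, v)). F v) \<in> borel_measurable (fibre_product N M)"

end

theory Submission
  imports Defs
begin

text \<open>
  Fix a dense sequence of Borel sections \<open>\<phi> i\<close>. A ball around \<open>\<phi> n x\<close> is relatively compact iff it is
  totally bounded, and this is a countable condition on the distances between the points \<open>\<phi> i x\<close>. So
  the points of the sequence that lie in relatively compact balls give an exhaustion of \<open>V x\<close> by compact
  sets that is Borel in \<open>x\<close>. A sequence \<open>a\<close> of complex numbers has the form \<open>a i = F (\<phi> i x)\<close> with \<open>F\<close>
  continuous iff it is uniformly continuous on each set of this exhaustion, which is a Borel condition
  on \<open>(x, a)\<close>. Therefore \<open>(x, F) \<mapsto> (x, (F (\<phi> i x)) i)\<close> identifies \<open>C(V)\<close> with a Borel subset of the
  product of \<open>X\<close> and the space of complex sequences, and pulling back the Borel structure gives existence.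
  All other measurability claims are checked on the coordinates \<open>F (\<phi> i x)\<close>.

  Every other admissible structure contains this one, and nested standard Borel structures on the
  same set coincide: choose countably many sets of the smaller structure that separate points; by Luzin's
  separation theorem the \<open>\<sigma>\<close>-algebra they generate contains every set of the larger structure.
\<close>

section \<open>Luzin separation\<close>

text \<open>The obstacle to existence is that the image of the sampling map has to be a Borel set.
  That some continuous \<open>F\<close> has prescribed values, or that some compact neighbourhood
  exists, quantifies over uncountably many objects and by itself suggests only an analytic
  condition. Completeness and local compactness turn both statements into quantifiers over natural
  numbers about the distances \<open>\<D> x i j\<close>: every point has a neighbourhood inside one
  set of the exhaustion, so uniform continuity there suffices to define \<open>F\<close> by limits.
  The same principle governs the rest: the metric on the function spaces is a countable supremum
  over sampled values, and the dense sections are explicit formulas in the distances to the sample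
  points, so that no selection theorem is needed. Analytic sets enter only through uniqueness, where
  a bijection that is measurable in one direction has to be shown measurable in the other.\<close>

text \<open>
  Analytic sets, with continuity of the parametrisation tested only against the functions in \<open>G\<close>, which
  take the place of a topology. Adding indicators of Borel sets to \<open>G\<close> then plays the role of refining
  a Polish topology to make these sets clopen.
\<close>

definition souslin :: "('a \<Rightarrow> real) set \<Rightarrow> 'a set \<Rightarrow> bool" where
  "souslin G E \<longleftrightarrow> (\<exists>(T :: (nat \<Rightarrow> nat) set) h.
     closed T \<and> h ` T = E \<and> (\<forall>g\<in>G. continuous_on T (\<lambda>t. g (h t))))"

lemma souslin_empty: "souslin G {}"
  unfolding souslin_def by (intro exI[of _ "{}"]) auto

lemma souslin_mono: "souslin G E \<Longrightarrow> F \<subseteq> G \<Longrightarrow> souslin F E"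
  unfolding souslin_def by blast

text \<open>Along any parametrisation of \<open>E\<close> the new function stays constant, so the
  old parametrisation serves unchanged. It is meant for the indicator of a set, on the set and on
  its complement separately.\<close>

lemma souslin_insert_const:
  assumes "souslin G E" "\<And>x. x \<in> E \<Longrightarrow> f x = c"
  shows "souslin (insert f G) E"
proof -
  obtain T h where Th: "closed (T :: (nat \<Rightarrow> nat) set)" "h ` T = E"
    "\<And>g. g \<in> G \<Longrightarrow> continuous_on T (\<lambda>t. g (h t))"
    using assms(1) unfolding souslin_def by blast
  have "continuous_on T (\<lambda>t. f (h t))"
    by (rule continuous_on_eq[OF continuous_on_const[of _ c]]) (use Th assms(2) in auto)
  with Th show ?thesis unfolding souslin_def by blast
qed

lemma souslin_closed_preimage:
  assumes "souslin G E" "g \<in> G" "closed A"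
  shows "souslin G {x \<in> E. g x \<in> A}"
proof -
  obtain T h where Th: "closed (T :: (nat \<Rightarrow> nat) set)" "h ` T = E"
    "\<And>g. g \<in> G \<Longrightarrow> continuous_on T (\<lambda>t. g (h t))"
    using assms(1) unfolding souslin_def by blast
  let ?T = "T \<inter> (\<lambda>t. g (h t)) -` A"
  have "closed ?T"
    using continuous_closed_preimage[OF Th(3)[OF assms(2)] Th(1) assms(3)] .
  moreover have "h ` ?T = {x \<in> E. g x \<in> A}" using Th(2) by auto
  moreover have "\<forall>g\<in>G. continuous_on ?T (\<lambda>t. g (h t))"
    using Th(3) continuous_on_subset by blast
  ultimately show ?thesis unfolding souslin_def by blast
qed

text \<open>The first entry of a parameter selects the set, and the shifted sequence parametrises
  it. The sets \<open>{t. t 0 = n}\<close> are open and partition the parameters, so closedness and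
  continuity may be checked on each of them.\<close>

lemma souslin_UN:
  fixes A :: "nat \<Rightarrow> 'a set"
  assumes "\<And>n. souslin G (A n)"
  shows "souslin G (\<Union>n. A n)"
proof -
  obtain T h where Th: "\<And>n. closed (T n :: (nat \<Rightarrow> nat) set)" "\<And>n. h n ` T n = A n"
    "\<And>n g. g \<in> G \<Longrightarrow> continuous_on (T n) (\<lambda>t. g (h n t))"
    using assms unfolding souslin_def by metis
  define s where "s = (\<lambda>(t :: nat \<Rightarrow> nat) k. t (Suc k))"
  have s: "continuous_on UNIV s" unfolding s_def
    by (intro continuous_on_coordinatewise_then_product continuous_on_product_coordinates)
  have 0: "open {t :: nat \<Rightarrow> nat. t 0 = n}" for n
  proof -
    have "open ((\<lambda>t :: nat \<Rightarrow> nat. t 0) -` {n})"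
      by (intro open_vimage continuous_on_product_coordinates open_discrete)
    then show ?thesis by (simp add: vimage_def)
  qed
  let ?T = "{t. s t \<in> T (t 0)}"
  let ?h = "\<lambda>t. h (t 0) (s t)"
  have "- ?T = (\<Union>n. {t. t 0 = n} \<inter> s -` (- T n))" by auto
  then have "open (- ?T)"
    using 0 s Th(1) by (auto intro!: open_UN open_Int open_vimage simp: open_Compl)
  then have "closed ?T" by (simp add: closed_def)
  moreover have "?h ` ?T = (\<Union>n. A n)"
  proof (intro equalityI subsetI)
    fix x assume "x \<in> (\<Union>n. A n)"
    then obtain n t where t: "t \<in> T n" "x = h n t" using Th(2) by blast
    have "s (case_nat n t) = t" by (auto simp: s_def)
    then show "x \<in> ?h ` ?T" using t by (intro image_eqI[of _ _ "case_nat n t"]) auto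
  qed (use Th(2) in blast)
  moreover have "continuous_on ?T (\<lambda>t. g (?h t))" if g: "g \<in> G" for g
    unfolding continuous_on_open_invariant
  proof (intro allI impI)
    fix B :: "real set" assume "open B"
    then have "\<forall>n. \<exists>U. open U \<and> U \<inter> T n = (\<lambda>t. g (h n t)) -` B \<inter> T n"
      using Th(3)[OF g] unfolding continuous_on_open_invariant by blast
    then obtain U where U: "\<And>n. open (U n)" "\<And>n. U n \<inter> T n = (\<lambda>t. g (h n t)) -` B \<inter> T n"
      by metis
    let ?U = "\<Union>n. {t. t 0 = n} \<inter> s -` U n"
    have "open ?U" using 0 s U(1) by (intro open_UN open_Int open_vimage ballI) auto
    moreover have "?U \<inter> ?T = (\<lambda>t. g (?h t)) -` B \<inter> ?T" using U(2) by blast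
    ultimately show "\<exists>U. open U \<and> U \<inter> ?T = (\<lambda>t. g (?h t)) -` B \<inter> ?T" by blast
  qed
  ultimately show ?thesis unfolding souslin_def by (intro exI[of _ ?T] exI[of _ ?h]) blast
qed

lemma souslin_Un:
  assumes "souslin G A" "souslin G B"
  shows "souslin G (A \<union> B)"
proof -
  have "A \<union> B = (\<Union>n::nat. if n = 0 then A else B)" by (auto split: if_splits)
  then show ?thesis using souslin_UN[of G "\<lambda>n. if n = 0 then A else B"] assms by simp
qed

text \<open>
  The parameter space is the fibre product of the given ones over the common value.
\<close>

lemma souslin_INT:
  fixes A :: "nat \<Rightarrow> 'a set"
  assumes A: "\<And>n. souslin (G n) (A n)" and G0: "\<And>n. G0 \<subseteq> G n"
    and sep: "\<And>x y. x \<in> (\<Union>n. A n) \<Longrightarrow> y \<in> (\<Union>n. A n) \<Longrightarrow> (\<And>g. g \<in> G0 \<Longrightarrow> g x = g y) \<Longrightarrow> x = y"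
  shows "souslin (\<Union>n. G n) (\<Inter>n. A n)"
proof -
  obtain T h where Th: "\<And>n. closed (T n :: (nat \<Rightarrow> nat) set)" "\<And>n. h n ` T n = A n"
    "\<And>n g. g \<in> G n \<Longrightarrow> continuous_on (T n) (\<lambda>t. g (h n t))"
    using A unfolding souslin_def by metis
  \<comment> \<open>One parameter codes countably many: \<open>p n\<close> extracts the
    \<open>n\<close>-th row of a sequence arranged as a matrix.\<close>
  define p where "p = (\<lambda>n (t :: nat \<Rightarrow> nat) k. t (prod_encode (n, k)))"
  have "continuous_on UNIV (p n)" for n unfolding p_def
    by (intro continuous_on_coordinatewise_then_product continuous_on_product_coordinates)
  then have p: "continuous_on S (p n)" for n S using continuous_on_subset by blast
  let ?T1 = "\<Inter>n. p n -` T n"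
  let ?h = "\<lambda>t. h 0 (p 0 t)"
  have T1: "closed ?T1" using Th(1) p by (auto intro!: closed_vimage)
  have cont: "continuous_on ?T1 (\<lambda>t. g (h n (p n t)))" if "g \<in> G n" for n g
    by (rule continuous_on_compose2[OF Th(3)[OF that] p]) auto
  \<comment> \<open>Nothing is known about \<open>h n\<close> beyond the functions in
    \<open>G n\<close>, so equality of two values need not be visibly closed. Agreement of all
    \<open>g\<close> in \<open>G0\<close> is a closed condition, and \<open>sep\<close> turns it
    into equality.\<close>
  let ?T = "?T1 \<inter> (\<Inter>n. \<Inter>g\<in>G0. {t \<in> ?T1. g (h n (p n t)) - g (?h t) = 0})"
  have "closed {t \<in> ?T1. g (h n (p n t)) - g (?h t) = 0}" if "g \<in> G0" for g n
    using G0 that by (intro continuous_closed_preimage_constant T1 continuous_on_diff cont) auto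
  then have closed: "closed ?T" by (intro closed_Int T1 closed_INT ballI)
  have eq: "h n (p n t) = ?h t" if "t \<in> ?T" for n t
  proof (rule sep)
    have "p n t \<in> T n" "p 0 t \<in> T 0" using that by auto
    then show "h n (p n t) \<in> (\<Union>n. A n)" "?h t \<in> (\<Union>n. A n)" using Th(2) by blast+
  qed (use that in auto)
  have image: "?h ` ?T = (\<Inter>n. A n)"
  proof (intro equalityI subsetI)
    fix x assume "x \<in> ?h ` ?T"
    then obtain t where t: "t \<in> ?T" "x = ?h t" by blast
    have "x \<in> A n" for n
    proof -
      have "x = h n (p n t)" using t(2) eq[OF t(1)] by metis
      moreover have "p n t \<in> T n" using t(1) by blast
      ultimately show ?thesis using Th(2) by blast
    qed
    then show "x \<in> (\<Inter>n. A n)" by blast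
  next
    fix x assume "x \<in> (\<Inter>n. A n)"
    then have "x \<in> h n ` T n" for n using Th(2) by simp
    then have "\<forall>n. \<exists>t. t \<in> T n \<and> h n t = x" by (metis imageE)
    then obtain u where u: "\<And>n. u n \<in> T n" "\<And>n. h n (u n) = x" by metis
    define t where "t = (\<lambda>k. case prod_decode k of (n, j) \<Rightarrow> u n j)"
    have "p n t = u n" for n unfolding p_def t_def by simp
    then have "t \<in> ?T" "x = ?h t" using u by simp_all
    then show "x \<in> ?h ` ?T" by (intro image_eqI)
  qed
  have cont_h: "continuous_on ?T (\<lambda>t. g (?h t))" if "g \<in> (\<Union>n. G n)" for g
  proof -
    from that obtain n where "g \<in> G n" by blast
    \<comment> \<open>Continuity of \<open>g\<close> comes from the parametrisation with
      \<open>g \<in> G n\<close>; since all parametrisations agree on \<open>?T\<close>, it passes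
      to \<open>?h\<close>. This is how the intersection acquires the union of all the function
      classes.\<close>
    then have "continuous_on ?T (\<lambda>t. g (h n (p n t)))"
      by (intro continuous_on_subset[OF cont]) auto
    then show ?thesis
    proof (rule continuous_on_eq)
      fix t assume "t \<in> ?T"
      from eq[OF this, of n] show "g (h n (p n t)) = g (?h t)" by (rule arg_cong)
    qed
  qed
  show ?thesis unfolding souslin_def
    by (rule exI[of _ ?T], rule exI[of _ ?h], intro conjI ballI) (fact closed image cont_h)+
qed

text \<open>Souslin sets are not closed under complements, so the induction carries the complement
  along: the complement of a union is handled by \<open>souslin_INT\<close>.\<close>

lemma souslin_sigma_sets:
  assumes sep: "\<And>x y. x \<in> M \<Longrightarrow> y \<in> M \<Longrightarrow> (\<And>g. g \<in> G \<Longrightarrow> g x = g y) \<Longrightarrow> x = y"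
    and M: "souslin G M"
    and U: "\<And>A. A \<in> U \<Longrightarrow> A \<subseteq> M \<and> souslin G A \<and> souslin G (M - A)"
    and A: "A \<in> sigma_sets M U"
  shows "A \<subseteq> M \<and> souslin G A \<and> souslin G (M - A)"
  using A
proof (induction rule: sigma_sets.induct)
  case (Union A)
  have "souslin (\<Union>n::nat. G) (\<Inter>n. M - A n)"
    by (rule souslin_INT[of _ _ G]) (use Union.IH sep in auto)
  then have "souslin G (M - (\<Union>n. A n))" by simp
  with Union.IH souslin_UN[of G A] show ?case by blast
qed (use U M souslin_empty in \<open>auto simp: double_diff\<close>)

text \<open>\<open>E\<close> is intersected with countably many copies of \<open>M\<close>, which
  does not change the set. The copy at index \<open>Suc n\<close> has a parametrisation for which
  the indicator of \<open>C n\<close> is continuous too, and the intersection inherits all of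
  these.\<close>

lemma souslin_indicators:
  fixes C :: "nat \<Rightarrow> 'a set"
  assumes sep: "\<And>x y. x \<in> M \<Longrightarrow> y \<in> M \<Longrightarrow> (\<And>g. g \<in> G \<Longrightarrow> g x = g y) \<Longrightarrow> x = y"
    and C: "\<And>n. C n \<subseteq> M \<and> souslin G (C n) \<and> souslin G (M - C n)"
    and E: "E \<subseteq> M" "souslin G E"
  shows "souslin (range (\<lambda>n. indicator (C n))) E"
proof -
  define A where "A = case_nat E (\<lambda>_. M)"
  define H where "H = case_nat G (\<lambda>n. insert (indicator (C n)) G)"
  have "souslin (insert (indicator (C n)) G) (C n \<union> (M - C n))" for n
    using C by (intro souslin_Un souslin_insert_const[of _ _ _ 1] souslin_insert_const[of _ _ _ 0])
      (auto simp: indicator_def)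
  moreover have "C n \<union> (M - C n) = M" for n using C by blast
  ultimately have "souslin (H n) (A n)" for n
    unfolding A_def H_def using E by (auto split: nat.split)
  moreover have "G \<subseteq> H n" for n unfolding H_def by (auto split: nat.split)
  moreover have "\<And>n. A n \<subseteq> M" unfolding A_def using E by (auto split: nat.split)
  ultimately have "souslin (\<Union>n. H n) (\<Inter>n. A n)"
  proof (intro souslin_INT[of H A G])
    fix x y assume "x \<in> (\<Union>n. A n)" "y \<in> (\<Union>n. A n)" "\<And>g. g \<in> G \<Longrightarrow> g x = g y"
    then show "x = y" using sep \<open>\<And>n. A n \<subseteq> M\<close> by blast
  qed
  moreover have "(\<Inter>n. A n) = E"
    using E unfolding A_def by (auto split: nat.splits)
  moreover have "range (\<lambda>n. indicator (C n)) \<subseteq> (\<Union>n. H n)"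
  proof clarify
    fix n show "indicator (C n) \<in> (\<Union>n. H n)"
      unfolding H_def by (intro UN_I[of "Suc n"]) auto
  qed
  ultimately show ?thesis using souslin_mono by metis
qed

definition borel_separated :: "'a set \<Rightarrow> (nat \<Rightarrow> 'a set) \<Rightarrow> 'a set \<Rightarrow> 'a set \<Rightarrow> bool" where
  "borel_separated M C A B \<longleftrightarrow> (\<exists>S \<in> sigma_sets M (range C). A \<subseteq> S \<and> S \<inter> B = {})"

text \<open>For fixed \<open>m\<close> the intersection of all \<open>S m n\<close> still contains
  \<open>A m\<close> and misses every \<open>B n\<close>; the union over \<open>m\<close> then
  separates. It is used in contraposed form: if two unions cannot be separated, some pair of pieces
  cannot.\<close>

lemma borel_separated_UN:
  fixes A B :: "nat \<Rightarrow> 'a set"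
  assumes "\<And>m n. borel_separated M C (A m) (B n)" and C: "range C \<subseteq> Pow M"
  shows "borel_separated M C (\<Union>m. A m) (\<Union>n. B n)"
proof -
  obtain S where S: "\<And>m n. S m n \<in> sigma_sets M (range C)" "\<And>m n. A m \<subseteq> S m n"
    "\<And>m n. S m n \<inter> B n = {}"
    using assms(1) unfolding borel_separated_def by metis
  have "(\<Union>m. \<Inter>n. S m n) \<in> sigma_sets M (range C)"
    using S(1) by (intro sigma_sets.Union sigma_sets_Inter[OF C])
  moreover have "(\<Union>m. A m) \<subseteq> (\<Union>m. \<Inter>n. S m n)" using S(2) by blast
  moreover have "(\<Union>m. \<Inter>n. S m n) \<inter> (\<Union>n. B n) = {}" using S(3) by blast
  ultimately show ?thesis unfolding borel_separated_def by blast
qed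

text \<open>
  If \<open>A\<close> and \<open>B\<close> cannot be separated, then neither can some pair of cylinders at every depth. The branches
  found in this way have values that some \<open>C n\<close> distinguishes, and by continuity it separates the
  cylinders at a sufficient depth.
\<close>

lemma luzin_separation:
  fixes C :: "nat \<Rightarrow> 'a set"
  assumes "souslin (range (\<lambda>n. indicator (C n))) A" "souslin (range (\<lambda>n. indicator (C n))) B"
    and sub: "\<And>n. C n \<subseteq> M" "A \<subseteq> M" "B \<subseteq> M"
    and dist: "\<And>a b. a \<in> A \<Longrightarrow> b \<in> B \<Longrightarrow> \<exists>n. (a \<in> C n) \<noteq> (b \<in> C n)"
  shows "borel_separated M C A B"
proof (rule ccontr)
  assume neg: "\<not> borel_separated M C A B"
  obtain T h where Th: "closed (T :: (nat \<Rightarrow> nat) set)" "h ` T = A"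
    "\<And>n. continuous_on T (\<lambda>t. indicator (C n) (h t) :: real)"
    using assms(1) unfolding souslin_def by auto
  obtain T' h' where Th': "closed (T' :: (nat \<Rightarrow> nat) set)" "h' ` T' = B"
    "\<And>n. continuous_on T' (\<lambda>t. indicator (C n) (h' t) :: real)"
    using assms(2) unfolding souslin_def by auto
  \<comment> \<open>\<open>R T k u\<close> is the cylinder of depth \<open>k\<close> around
    \<open>u\<close> within \<open>T\<close>; refining it means fixing one more entry.\<close>
  define R where "R = (\<lambda>(T :: (nat \<Rightarrow> nat) set) k u. {t \<in> T. \<forall>i<k. t i = u i})"
  have RUN: "R S k u = (\<Union>n. R S (Suc k) (u(k := n)))" for S k u
    unfolding R_def by (auto simp: less_Suc_eq)
  define P where "P = (\<lambda>k (u, v). \<not> borel_separated M C (h ` R T k u) (h' ` R T' k v))"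
  \<comment> \<open>\<open>Q\<close> records that a refinement leaves the first \<open>k\<close>
    entries alone, so that the chosen pairs of sequences stabilise entrywise and have a diagonal
    limit.\<close>
  define Q where "Q = (\<lambda>k (u :: nat \<Rightarrow> nat, v :: nat \<Rightarrow> nat) (u', v'). \<forall>i<k. u' i = u i \<and> v' i = v i)"
  have "\<exists>f. \<forall>k. P k (f k) \<and> Q k (f k) (f (Suc k))"
  proof (rule dependent_nat_choice)
    show "\<exists>x. P 0 x" using neg Th(2) Th'(2) by (auto simp: P_def R_def)
  next
    fix x k assume "P k x"
    obtain u v where x: "x = (u, v)" by fastforce
    have "\<exists>m n. \<not> borel_separated M C (h ` R T (Suc k) (u(k := m))) (h' ` R T' (Suc k) (v(k := n)))"
    proof (rule ccontr)
      assume "\<not> ?thesis"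
      then have "borel_separated M C (\<Union>m. h ` R T (Suc k) (u(k := m))) (\<Union>n. h' ` R T' (Suc k) (v(k := n)))"
        using sub(1) by (intro borel_separated_UN) blast+
      then show False
        using \<open>P k x\<close> unfolding x P_def by (simp add: RUN[of _ k] image_UN)
    qed
    then obtain m n where "P (Suc k) (u(k := m), v(k := n))" unfolding P_def by auto
    moreover have "Q k x (u(k := m), v(k := n))" unfolding Q_def x by auto
    ultimately show "\<exists>y. P (Suc k) y \<and> Q k x y" by blast
  qed
  then obtain f where f: "\<And>k. P k (f k)" "\<And>k. Q k (f k) (f (Suc k))" by blast
  have stable: "fst (f k) i = fst (f (Suc i)) i \<and> snd (f k) i = snd (f (Suc i)) i" if "i < k" for i k
    using that
  proof (induction k)
    case (Suc k)
    show ?case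
    proof (cases "i = k")
      case False
      then have "i < k" using Suc.prems by simp
      then show ?thesis using Suc.IH f(2)[of k] unfolding Q_def by (auto simp: case_prod_unfold)
    qed simp
  qed simp
  define w where "w = (\<lambda>i. fst (f (Suc i)) i)"
  define w' where "w' = (\<lambda>i. snd (f (Suc i)) i)"
  have "R S k (fst (f k)) = R S k w \<and> R S k (snd (f k)) = R S k w'" for S k
    using stable[of _ k] unfolding R_def w_def w'_def by auto
  then have nsep: "\<not> borel_separated M C (h ` R T k w) (h' ` R T' k w')" for k
    using f(1)[of k] unfolding P_def by (auto simp: case_prod_unfold)
  \<comment> \<open>An empty piece would be separated by \<open>{}\<close> or by
    \<open>M\<close>.\<close>
  have nonempty: "R T k w \<noteq> {}" "R T' k w' \<noteq> {}" for k
  proof -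
    have "{} \<in> sigma_sets M (range C)" "M \<in> sigma_sets M (range C)"
      by (auto intro: sigma_sets.Empty sigma_sets_top)
    moreover have "h ` R T k w \<subseteq> M" using Th(2) sub by (auto simp: R_def)
    ultimately show "R T k w \<noteq> {}" "R T' k w' \<noteq> {}"
      using nsep[of k] unfolding borel_separated_def by auto
  qed
  have tends: "s \<longlonglongrightarrow> u" if "\<And>k. s k \<in> R S k u" for s u S
  proof -
    have "\<forall>i. (\<lambda>k. s k i) \<longlonglongrightarrow> u i"
    proof
      fix i
      have "\<forall>\<^sub>F k in sequentially. s k i = u i"
        using that unfolding R_def eventually_sequentially by (intro exI[of _ "Suc i"]) auto
      then show "(\<lambda>k. s k i) \<longlonglongrightarrow> u i" by (rule tendsto_eventually)
    qed
    then have "limitin (product_topology (\<lambda>_. euclidean) UNIV) s u sequentially"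
      by (simp add: limitin_componentwise)
    then show ?thesis by (simp add: euclidean_product_topology)
  qed
  \<comment> \<open>Points of ever deeper cylinders converge to \<open>u\<close>, which lies in
    \<open>S\<close> because \<open>S\<close> is closed. A continuous function with values 0 and 1
    is locally constant, hence constant on a sufficiently deep cylinder.\<close>
  have key: "u \<in> S \<and> (\<exists>k. \<forall>t\<in>R S k u. (g t \<in> C n) = (g u \<in> C n))"
    if S: "closed S" "\<And>n. continuous_on S (\<lambda>t. indicator (C n) (g t) :: real)"
      "\<And>k. R S k u \<noteq> {}" for S :: "(nat \<Rightarrow> nat) set" and g :: "(nat \<Rightarrow> nat) \<Rightarrow> 'a" and u n
  proof -
    have "\<forall>k. \<exists>t. t \<in> R S k u" using S(3) by blast
    then obtain s where s: "\<And>k. s k \<in> R S k u" by metis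
    have u: "u \<in> S"
      using closed_sequentially[OF S(1) _ tends[of s S u, OF s]] s unfolding R_def by auto
    have "\<exists>k. \<forall>t\<in>R S k u. (g t \<in> C n) = (g u \<in> C n)"
    proof (rule ccontr)
      assume "\<not> ?thesis"
      then obtain s where s: "\<And>k. s k \<in> R S k u" "\<And>k. (g (s k) \<in> C n) \<noteq> (g u \<in> C n)" by metis
      have "(\<lambda>k. indicator (C n) (g (s k)) :: real) \<longlonglongrightarrow> indicator (C n) (g u)"
        using continuous_on_tendsto_compose[OF S(2) tends[of s S u, OF s(1)] u] s(1)
        unfolding R_def by auto
      moreover have "indicator (C n) (g (s k)) = (1 - indicator (C n) (g u) :: real)" for k
        using s(2)[of k] by (auto simp: indicator_def)
      ultimately have "indicator (C n) (g u) = (1 - indicator (C n) (g u) :: real)"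
        by (simp add: LIMSEQ_const_iff)
      then show False by (cases "g u \<in> C n") simp_all
    qed
    with u show ?thesis by blast
  qed
  have wT: "w \<in> T" "w' \<in> T'"
    using key[OF Th(1,3) nonempty(1)] key[OF Th'(1,3) nonempty(2)] by blast+
  then obtain n where n: "(h w \<in> C n) \<noteq> (h' w' \<in> C n)" using dist Th(2) Th'(2) by blast
  obtain k k' where k: "\<And>t. t \<in> R T k w \<Longrightarrow> (h t \<in> C n) = (h w \<in> C n)"
      "\<And>t. t \<in> R T' k' w' \<Longrightarrow> (h' t \<in> C n) = (h' w' \<in> C n)"
    using key[OF Th(1,3) nonempty(1), of n] key[OF Th'(1,3) nonempty(2), of n] by blast
  let ?k = "max k k'"
  have "R T ?k w \<subseteq> R T k w" "R T' ?k w' \<subseteq> R T' k' w'" unfolding R_def by auto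
  then have k: "\<And>t. t \<in> R T ?k w \<Longrightarrow> (h t \<in> C n) = (h w \<in> C n)"
      "\<And>t. t \<in> R T' ?k w' \<Longrightarrow> (h' t \<in> C n) = (h' w' \<in> C n)"
    using k by blast+
  have C: "C n \<in> sigma_sets M (range C)" "M - C n \<in> sigma_sets M (range C)"
    by (auto intro: sigma_sets.intros)
  have "borel_separated M C (h ` R T ?k w) (h' ` R T' ?k w')"
  proof (cases "h w \<in> C n")
    case True
    have "h x \<in> C n" if "x \<in> R T ?k w" for x using k(1)[OF that] True by (rule iffD2)
    then have "h ` R T ?k w \<subseteq> C n" by (rule image_subsetI)
    moreover have "h' y \<notin> C n" if "y \<in> R T' ?k w'" for y using k(2)[OF that] True n by simp
    then have "C n \<inter> h' ` R T' ?k w' = {}" by auto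
    ultimately show ?thesis unfolding borel_separated_def by (intro bexI[OF _ C(1)] conjI)
  next
    case False
    have "h x \<in> M - C n" if "x \<in> R T ?k w" for x
      using k(1)[OF that] False that Th(2) sub unfolding R_def by auto
    then have "h ` R T ?k w \<subseteq> M - C n" by (rule image_subsetI)
    moreover have "h' y \<in> C n" if "y \<in> R T' ?k w'" for y using k(2)[OF that] False n by simp
    then have "(M - C n) \<inter> h' ` R T' ?k w' = {}" by auto
    ultimately show ?thesis unfolding borel_separated_def by (intro bexI[OF _ C(2)] conjI)
  qed
  then show False using nsep by blast
qed

text \<open>Parameters are index sequences along which consecutive points of \<open>c\<close> are
  within \<open>(1/2)^k\<close>. Each bound involves only two entries, so it is a closed condition;
  completeness provides a limit, and the geometric tail makes the convergence uniform in the
  parameter.\<close>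

lemma (in Metric_space) souslin_mspace:
  fixes c :: "nat \<Rightarrow> 'a"
  assumes "mcomplete" and c: "\<And>n. c n \<in> M" "mtopology closure_of range c = M"
  shows "souslin (range (\<lambda>n. d (c n))) M"
proof -
  have approx: "\<exists>n. d x (c n) < e" if "x \<in> M" "e > 0" for x e
  proof -
    have "x \<in> mtopology closure_of range c" using that c by simp
    then show ?thesis using that unfolding metric_closure_of by auto
  qed
  define T where "T = {t :: nat \<Rightarrow> nat. \<forall>k. d (c (t k)) (c (t (Suc k))) \<le> (1/2)^k}"
  have "open {t :: nat \<Rightarrow> nat. P (t i) (t j)}" for P i j
  proof -
    have "open (\<Union>a. (\<lambda>t :: nat \<Rightarrow> nat. t i) -` {a} \<inter> (\<lambda>t. t j) -` Collect (P a))"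
      by (intro open_UN open_Int open_vimage continuous_on_product_coordinates open_discrete ballI)
    moreover have "(\<Union>a. (\<lambda>t :: nat \<Rightarrow> nat. t i) -` {a} \<inter> (\<lambda>t. t j) -` Collect (P a)) = {t. P (t i) (t j)}"
      by auto
    ultimately show ?thesis by simp
  qed
  from this[of "\<lambda>a b. \<not> d (c a) (c b) \<le> e" for e]
  have cl1: "closed {t :: nat \<Rightarrow> nat. d (c (t k)) (c (t (Suc k))) \<le> (1/2)^k}" for k
    by (simp add: closed_def Collect_neg_eq[symmetric])
  have "closed T" unfolding T_def using cl1 by (intro closed_Collect_all)
  \<comment> \<open>The subtracted term makes the induction telescope; only the bound
    \<open>2 * (1/2)^n\<close> is needed afterwards.\<close>
  have tail: "d (c (t n)) (c (t (n + j))) \<le> 2 * (1/2)^n - 2 * (1/2)^(n+j)" if "t \<in> T" for t n j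
  proof (induction j)
    case (Suc j)
    have "d (c (t (n+j))) (c (t (Suc (n+j)))) \<le> (1/2)^(n+j)" using that unfolding T_def by blast
    moreover have "d (c (t n)) (c (t (n + Suc j)))
        \<le> d (c (t n)) (c (t (n + j))) + d (c (t (n+j))) (c (t (Suc (n+j))))"
      using triangle c by simp
    ultimately show ?case using Suc by simp
  qed (use c(1) in simp)
  have tail': "d (c (t n)) (c (t m)) \<le> 2 * (1/2)^n" if "t \<in> T" "n \<le> m" for t n m
  proof -
    have "d (c (t n)) (c (t m)) \<le> 2 * (1/2)^n - 2 * (1/2)^m"
      using tail[OF that(1), of n "m - n"] that(2) by (simp only: le_add_diff_inverse)
    moreover have "0 \<le> (1/2 :: real)^m" by simp
    ultimately show ?thesis by linarith
  qed
  have "\<exists>x. limitin mtopology (\<lambda>k. c (t k)) x sequentially" if t: "t \<in> T" for t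
  proof -
    have "MCauchy (\<lambda>k. c (t k))" unfolding MCauchy_def
    proof (intro conjI allI impI)
      fix e :: real assume "e > 0"
      then obtain N where N: "(1/2 :: real)^N < e / 4"
        using real_arch_pow_inv[of "e/4" "1/2"] by auto
      have "d (c (t n)) (c (t n')) < e" if "N \<le> n" "N \<le> n'" for n n'
      proof -
        note tail'[OF t that(1)] tail'[OF t that(2)] N triangle''[OF c(1) c(1) c(1), of "t n" "t n'" "t N"]
        then show ?thesis by linarith
      qed
      then show "\<exists>N. \<forall>n n'. N \<le> n \<longrightarrow> N \<le> n' \<longrightarrow> d (c (t n)) (c (t n')) < e"
        by (intro exI[of _ N] allI impI)
    qed (use c(1) in auto)
    then show ?thesis using assms(1) unfolding mcomplete_def by blast
  qed
  then obtain h where h: "\<And>t. t \<in> T \<Longrightarrow> limitin mtopology (\<lambda>k. c (t k)) (h t) sequentially"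
    by metis
  then have hM: "h t \<in> M" if "t \<in> T" for t using that limitin_mspace by blast
  have near: "d (c (t n)) (h t) \<le> 2 * (1/2)^n" if t: "t \<in> T" for t n
  proof (rule field_le_epsilon)
    fix e :: real assume "e > 0"
    then obtain N where N: "\<And>m. m \<ge> N \<Longrightarrow> d (c (t m)) (h t) < e"
      using h[OF t] unfolding limit_metric_sequentially by blast
    show "d (c (t n)) (h t) \<le> 2 * (1/2)^n + e"
      using N[of "max n N", OF max.cobounded2] tail'[OF t max.cobounded1, of n N]
        triangle[OF c(1) c(1) hM[OF t], of "t n" "t (max n N)"]
      by linarith
  qed
  have "h ` T = M"
  proof (intro equalityI subsetI)
    fix x assume x: "x \<in> M"
    \<comment> \<open>The exponent \<open>k+2\<close> leaves room for the triangle inequality: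
      consecutive points are then within \<open>(1/4 + 1/8) * (1/2)^k\<close>, below the bound
      required by \<open>T\<close>.\<close>
    have "\<exists>n. d x (c n) < (1/2)^(k+2)" for k by (rule approx[OF x]) simp
    then obtain t where t: "\<And>k. d x (c (t k)) < (1/2)^(k+2)" by metis
    have "d (c (t k)) (c (t (Suc k))) \<le> (1/2)^k" for k
    proof -
      have "d (c (t k)) (c (t (Suc k))) \<le> (1/2)^(k+2) + (1/2)^(Suc k+2)"
        using t[of k] t[of "Suc k"] triangle''[OF c(1) x c(1), of "t k" "t (Suc k)"] by linarith
      also have "\<dots> = 3/8 * (1/2)^k" by (simp add: power_add)
      also have "\<dots> \<le> 1 * (1/2)^k" by (rule mult_right_mono) auto
      finally show ?thesis by simp
    qed
    then have "t \<in> T" unfolding T_def by blast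
    have "limitin mtopology (\<lambda>k. c (t k)) x sequentially"
      unfolding limit_metric_sequentially
    proof (intro conjI allI impI x)
      fix e :: real assume "e > 0"
      then obtain N where N: "(1/2 :: real)^N < e"
        using real_arch_pow_inv[of "e" "1/2"] by auto
      have "d (c (t n)) x < e" if "n \<ge> N" for n
      proof -
        have "(1/2 :: real)^(n+2) \<le> (1/2)^N" using that by (intro power_decreasing) auto
        then show ?thesis using t[of n] N commute[of x] by simp
      qed
      then show "\<exists>N. \<forall>n\<ge>N. c (t n) \<in> M \<and> d (c (t n)) x < e" using c by blast
    qed
    then have "h t = x" using h[OF \<open>t \<in> T\<close>] limitin_metric_unique[of "\<lambda>k. c (t k)"] by auto
    then show "x \<in> h ` T" using \<open>t \<in> T\<close> by blast
  qed (use hM in blast)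
  \<comment> \<open>A distance to the \<open>n\<close>-th approximating point depends on a single
    discrete entry, hence is continuous; the estimate \<open>near\<close> makes these functions
    converge uniformly.\<close>
  moreover have "continuous_on T (\<lambda>t. d (c m) (h t))" for m
  proof (rule uniform_limit_theorem)
    show "\<forall>\<^sub>F n in sequentially. continuous_on T (\<lambda>t. d (c m) (c (t n)))"
    proof (intro always_eventually allI)
      fix n
      have "continuous_on UNIV (\<lambda>t :: nat \<Rightarrow> nat. t n)" by (rule continuous_on_product_coordinates)
      then have "continuous_on T (\<lambda>t. t n)" by (rule continuous_on_subset) simp
      then show "continuous_on T (\<lambda>t. d (c m) (c (t n)))"
        by (rule continuous_on_compose2[of UNIV "\<lambda>a. d (c m) (c a)", OF Topological_Spaces.continuous_on_discrete]) simp
    qed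
    show "uniform_limit T (\<lambda>n t. d (c m) (c (t n))) (\<lambda>t. d (c m) (h t)) sequentially"
    proof (rule uniform_limitI)
      fix e :: real assume "e > 0"
      then obtain N where N: "(1/2 :: real)^N < e / 2"
        using real_arch_pow_inv[of "e/2" "1/2"] by auto
      show "\<forall>\<^sub>F n in sequentially. \<forall>t\<in>T. dist (d (c m) (c (t n))) (d (c m) (h t)) < e"
        unfolding eventually_sequentially
      proof (intro exI[of _ N] allI impI ballI)
        fix n t assume n: "N \<le> n" and t: "t \<in> T"
        have "(1/2 :: real)^n \<le> (1/2)^N" using n by (intro power_decreasing) auto
        then have "d (c (t n)) (h t) < e" using near[OF t, of n] N by linarith
        moreover have "\<bar>d (c m) (c (t n)) - d (c m) (h t)\<bar> \<le> d (c (t n)) (h t)"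
          using mdist_reverse_triangle[OF c(1) c(1) hM[OF t], of "t n" m] by (simp only: commute[of "c (t n)"])
        ultimately show "dist (d (c m) (c (t n))) (d (c m) (h t)) < e" by (simp add: dist_real_def)
      qed
    qed
  qed simp
  ultimately show ?thesis unfolding souslin_def using \<open>closed T\<close>
    by (intro exI[of _ T] exI[of _ h] conjI ballI) auto
qed

section \<open>Standard Borel spaces\<close>

lemma space_borel_of [simp]: "space (borel_of T) = topspace T"
  unfolding borel_of_def by (simp add: space_measure_of_conv)

lemma sets_borel_of: "sets (borel_of T) = sigma_sets (topspace T) {U. openin T U}"
  unfolding borel_of_def by (rule sets_measure_of) (auto dest: openin_subset)

lemma borel_of_open: "openin T U \<Longrightarrow> U \<in> sets (borel_of T)"
  unfolding sets_borel_of by blast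

lemma sets_borel_of_euclidean: "sets (borel_of euclidean) = sets borel"
  unfolding sets_borel_of borel_def by simp

lemma measurable_borel_of:
  assumes "\<And>x. x \<in> space N \<Longrightarrow> f x \<in> topspace T"
    and "\<And>U. openin T U \<Longrightarrow> f -` U \<inter> space N \<in> sets N"
  shows "f \<in> measurable N (borel_of T)"
  unfolding borel_of_def
  by (rule measurable_measure_of) (use assms in \<open>auto dest: openin_subset\<close>)

lemma measurable_borel_of_continuous:
  assumes "continuous_map S T f"
  shows "f \<in> measurable (borel_of S) (borel_of T)"
proof (rule measurable_borel_of)
  fix U assume "openin T U"
  then have "openin S {x \<in> topspace S. f x \<in> U}"
    using assms by (simp add: continuous_map_def)
  moreover have "f -` U \<inter> space (borel_of S) = {x \<in> topspace S. f x \<in> U}" by auto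
  ultimately show "f -` U \<inter> space (borel_of S) \<in> sets (borel_of S)" using borel_of_open by metis
qed (use assms in \<open>auto simp: continuous_map_def Pi_iff\<close>)

lemma Polish_spaceE:
  assumes "Polish_space T" "topspace T \<noteq> {}"
  obtains M d and c :: "nat \<Rightarrow> 'a" where "Metric_space M d" "Metric_space.mcomplete M d"
    "T = Metric_space.mtopology M d" "M = topspace T" "\<And>n. c n \<in> M" "T closure_of range c = M"
proof -
  obtain M d where Md: "Metric_space M d" "Metric_space.mcomplete M d" "T = Metric_space.mtopology M d"
    using assms unfolding Polish_space_def completely_metrizable_space_def by blast
  interpret Metric_space M d by (rule Md)
  have top: "topspace T = M" using Md by simp
  obtain C where C: "countable C" "C \<subseteq> M" "T closure_of C = M"
    using assms top unfolding Polish_space_def separable_space_def by auto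
  have "C \<noteq> {}" using C assms top by auto
  then have range: "range (from_nat_into C) = C" using C by (simp add: range_from_nat_into)
  show ?thesis by (rule that[OF Md top[symmetric], of "from_nat_into C"]) (use C range in auto)
qed

context Metric_space
begin

text \<open>A countable base of the topology, written through the functions \<open>d (c n)\<close>
  because these are the functions for which the parametrisation of \<open>souslin_mspace\<close> is
  continuous.\<close>

definition small_balls :: "(nat \<Rightarrow> 'a) \<Rightarrow> 'a set set" where
  "small_balls c = range (\<lambda>(n, k). {x \<in> M. d (c n) x < inverse (real (Suc k))})"

lemma countable_small_balls: "countable (small_balls c)"
  unfolding small_balls_def by blast

context
  fixes c :: "nat \<Rightarrow> 'a"
  assumes c: "\<And>n. c n \<in> M" "mtopology closure_of range c = M"
begin

lemma dense_seq_approx: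
  assumes "x \<in> M" "e > 0"
  obtains n where "d (c n) x < e"
proof -
  have "x \<in> mtopology closure_of range c" using assms c by simp
  then show ?thesis using assms that unfolding metric_closure_of by (auto simp: commute)
qed

lemma openin_contains_small_ball:
  assumes U: "openin mtopology U" and x: "x \<in> U"
  shows "\<exists>B\<in>small_balls c. x \<in> B \<and> B \<subseteq> U"
proof -
  obtain r where r: "r > 0" "mball x r \<subseteq> U" and xM: "x \<in> M"
    using U x unfolding openin_mtopology by blast
  obtain k where k: "inverse (real (Suc k)) < r / 2" using reals_Archimedean r by (metis half_gt_zero)
  obtain n where n: "d (c n) x < inverse (real (Suc k))"
    using dense_seq_approx[OF xM, of "inverse (real (Suc k))"] by auto
  let ?B = "{x \<in> M. d (c n) x < inverse (real (Suc k))}"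
  have "?B \<subseteq> U"
  proof
    fix y assume y: "y \<in> ?B"
    then have "d x y < r" using triangle''[OF xM c(1), of y n] n k by auto
    then show "y \<in> U" using r y xM by auto
  qed
  moreover have "?B \<in> small_balls c" unfolding small_balls_def by (intro image_eqI[of _ _ "(n, k)"]) auto
  moreover have "x \<in> ?B" using xM n by simp
  ultimately show ?thesis by (intro bexI[of _ ?B] conjI)
qed

lemma sets_borel_of_mtopology: "sets (borel_of mtopology) = sigma_sets M (small_balls c)"
proof -
  have open_ball: "openin mtopology B" if B: "B \<in> small_balls c" for B
  proof -
    obtain n k where "B = {x \<in> M. d (c n) x < inverse (real (Suc k))}"
      using B unfolding small_balls_def by auto
    also have "\<dots> = mball (c n) (inverse (real (Suc k)))" using c by auto
    finally show ?thesis by simp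
  qed
  have "sigma_sets M {U. openin mtopology U} = sigma_sets M (small_balls c)"
  proof (rule sigma_sets_eqI)
    fix U assume "U \<in> {U. openin mtopology U}"
    then have "U = \<Union>{B \<in> small_balls c. B \<subseteq> U}"
      using openin_contains_small_ball by blast
    moreover have "\<Union>{B \<in> small_balls c. B \<subseteq> U} \<in> sigma_sets M (small_balls c)"
      by (rule sigma_sets_UNION) (auto intro: countable_subset[OF _ countable_small_balls])
    ultimately show "U \<in> sigma_sets M (small_balls c)" by simp
  qed (use open_ball in \<open>auto intro: sigma_sets.Basic\<close>)
  then show ?thesis by (simp add: sets_borel_of)
qed

lemma dense_seq_separates:
  assumes "x \<in> M" "y \<in> M" "\<And>n. d (c n) x = d (c n) y"
  shows "x = y"
proof (rule ccontr)
  assume "x \<noteq> y"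
  then obtain n where n: "d (c n) x < d x y / 2"
    using dense_seq_approx[of x "d x y / 2"] assms by auto
  then show False using triangle''[OF assms(1) c(1) assms(2), of n] assms(3)[of n] by linarith
qed

text \<open>The generators are handled by closed conditions on \<open>d (c n)\<close>: a small ball
  is a countable union of such conditions, with radii increasing to its own, and its complement is
  one such condition.\<close>

lemma souslin_borel:
  assumes "mcomplete" "A \<in> sets (borel_of mtopology)"
  shows "A \<subseteq> M \<and> souslin (range (\<lambda>n. d (c n))) A \<and> souslin (range (\<lambda>n. d (c n))) (M - A)"
proof (rule souslin_sigma_sets)
  show M: "souslin (range (\<lambda>n. d (c n))) M" by (rule souslin_mspace[OF assms(1) c])
  show "A \<in> sigma_sets M (small_balls c)" using assms(2) sets_borel_of_mtopology by simp
  show "x = y" if "x \<in> M" "y \<in> M" "\<And>g. g \<in> range (\<lambda>n. d (c n)) \<Longrightarrow> g x = g y" for x y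
    by (rule dense_seq_separates) (use that in auto)
  fix B assume "B \<in> small_balls c"
  then obtain n k where B: "B = {x \<in> M. d (c n) x < inverse (real (Suc k))}"
    unfolding small_balls_def by auto
  let ?r = "inverse (real (Suc k))"
  have BU: "B = (\<Union>j. {x \<in> M. d (c n) x \<in> {.. ?r - inverse (real (Suc j))}})"
  proof (intro equalityI subsetI)
    fix x assume "x \<in> B"
    then obtain j where "inverse (real (Suc j)) < ?r - d (c n) x" and "x \<in> M"
      using reals_Archimedean[of "?r - d (c n) x"] B by auto
    then show "x \<in> (\<Union>j. {x \<in> M. d (c n) x \<in> {.. ?r - inverse (real (Suc j))}})"
      by (intro UN_I[of j]) auto
  next
    fix x assume "x \<in> (\<Union>j. {x \<in> M. d (c n) x \<in> {.. ?r - inverse (real (Suc j))}})"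
    then obtain j where "x \<in> M" "d (c n) x \<le> ?r - inverse (real (Suc j))" by blast
    moreover have "inverse (real (Suc j)) > 0" by simp
    ultimately have "d (c n) x < ?r" by linarith
    then show "x \<in> B" unfolding B using \<open>x \<in> M\<close> by blast
  qed
  have "souslin (range (\<lambda>n. d (c n))) B"
    unfolding BU by (intro souslin_UN souslin_closed_preimage M) auto
  moreover have "souslin (range (\<lambda>n. d (c n))) {x \<in> M. d (c n) x \<in> {?r..}}"
    by (intro souslin_closed_preimage M) auto
  moreover have "M - B = {x \<in> M. d (c n) x \<in> {?r..}}" unfolding B by auto
  moreover have "B \<subseteq> M" unfolding B by blast
  ultimately show "B \<subseteq> M \<and> souslin (range (\<lambda>n. d (c n))) B \<and> souslin (range (\<lambda>n. d (c n))) (M - B)"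
    by simp
qed

end

end

section \<open>Nested standard Borel structures coincide\<close>

lemma standard_borel_separating_sequence:
  assumes "standard_borel N"
  obtains C :: "nat \<Rightarrow> 'a set" where "\<And>n. C n \<in> sets N"
    "\<And>x y. x \<in> space N \<Longrightarrow> y \<in> space N \<Longrightarrow> x \<noteq> y \<Longrightarrow> \<exists>n. (x \<in> C n) \<noteq> (y \<in> C n)"
proof (cases "space N = {}")
  case True
  then show ?thesis using that[of "\<lambda>_. {}"] by auto
next
  case False
  obtain P :: "real topology" and B f g where P: "Polish_space P" "B \<in> sets (borel_of P)"
    and f: "f \<in> measurable N (restrict_space (borel_of P) B)" "\<forall>x\<in>space N. g (f x) = x"
    using assms unfolding standard_borel_def by blast
  have f1: "f \<in> measurable N (borel_of P)"
    using f(1) by (simp add: measurable_restrict_space2_iff)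
  have f2: "\<And>x. x \<in> space N \<Longrightarrow> f x \<in> topspace P"
    using measurable_space[OF f1] by simp
  then have "topspace P \<noteq> {}" using False by auto
  then obtain M d and c :: "nat \<Rightarrow> real" where Md: "Metric_space M d" "P = Metric_space.mtopology M d"
     "M = topspace P" and c: "\<And>n. c n \<in> M" "P closure_of range c = M"
    using Polish_spaceE[OF P(1)] by metis
  interpret Metric_space M d by (rule Md)
  have c': "mtopology closure_of range c = M" using c(2) Md(2) by simp
  have "small_balls c \<noteq> {}" unfolding small_balls_def by blast
  then have "range (from_nat_into (small_balls c)) = small_balls c"
    using countable_small_balls by (intro range_from_nat_into)
  then obtain S where S: "small_balls c = range (S :: nat \<Rightarrow> real set)" by metis
  show ?thesis
  proof (rule that[of "\<lambda>n. f -` S n \<inter> space N"])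
    show "f -` S n \<inter> space N \<in> sets N" for n
    proof (rule measurable_sets[OF f1])
      show "S n \<in> sets (borel_of P)"
        using sets_borel_of_mtopology[OF c(1) c'] S Md(2) by (auto intro: sigma_sets.Basic)
    qed
    fix x y assume xy: "x \<in> space N" "y \<in> space N" "x \<noteq> y"
    then have "f x \<noteq> f y" using f(2) by metis
    moreover have M: "f x \<in> M" "f y \<in> M" using xy f2 Md(3) by auto
    ultimately have "openin mtopology (M - {f y})" "f x \<in> M - {f y}"
      using Hausdorff_space_mtopology by (auto intro!: openin_diff closedin_Hausdorff_singleton)
    then obtain n where "f x \<in> S n" "S n \<subseteq> M - {f y}"
      using openin_contains_small_ball[OF c(1) c'] unfolding S by blast
    then show "\<exists>n. (x \<in> f -` S n \<inter> space N) \<noteq> (y \<in> f -` S n \<inter> space N)"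
      using xy by (intro exI[of _ n]) auto
  qed
qed

text \<open>The argument is carried out in the model \<open>B\<close> of the larger structure, where
  \<open>E\<close> and its complement become disjoint Borel sets. A set generated by the transported
  separating sequence lies between them, so it equals \<open>E\<close>, and what is generated by
  that sequence belongs to the smaller structure.\<close>

lemma standard_borel_sets_eqI:
  assumes "standard_borel N" "standard_borel N'" "space N = space N'" "sets N \<subseteq> sets N'"
  shows "sets N = sets N'"
proof (rule equalityI[OF assms(4)], rule subsetI)
  fix E assume E: "E \<in> sets N'"
  show "E \<in> sets N"
  proof (cases "E = {}")
    case False
    obtain C :: "nat \<Rightarrow> 'a set" where C: "\<And>n. C n \<in> sets N"
      "\<And>x y. x \<in> space N \<Longrightarrow> y \<in> space N \<Longrightarrow> x \<noteq> y \<Longrightarrow> \<exists>n. (x \<in> C n) \<noteq> (y \<in> C n)"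
      using standard_borel_separating_sequence[OF assms(1)] by metis
    obtain P :: "real topology" and B f g where P: "Polish_space P" and B: "B \<in> sets (borel_of P)"
      and f: "f \<in> measurable N' (restrict_space (borel_of P) B)" "\<And>x. x \<in> space N' \<Longrightarrow> g (f x) = x"
      and g: "g \<in> measurable (restrict_space (borel_of P) B) N'" "\<And>y. y \<in> B \<Longrightarrow> f (g y) = y"
      using assms(2) unfolding standard_borel_def by blast
    have fB: "f x \<in> B" if "x \<in> space N'" for x
      using measurable_space[OF f(1) that] by (simp add: space_restrict_space)
    have BP: "B \<subseteq> topspace P" using sets.sets_into_space[OF B] by simp
    have gN: "g y \<in> space N'" if "y \<in> B" for y
      using measurable_space[OF g(1)] that BP by (auto simp: space_restrict_space)
    have pre: "g -` A \<inter> B \<in> sets (borel_of P)" if "A \<in> sets N'" for A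
    proof -
      have "g -` A \<inter> space (restrict_space (borel_of P) B) \<in> sets (restrict_space (borel_of P) B)"
        by (rule measurable_sets[OF g(1) that])
      moreover have "space (restrict_space (borel_of P) B) = B"
        using BP by (auto simp: space_restrict_space)
      ultimately show ?thesis using B by (auto simp: sets_restrict_space)
    qed
    have "topspace P \<noteq> {}" using False E fB sets.sets_into_space[OF E] BP by blast
    then obtain M d and c :: "nat \<Rightarrow> real" where Md: "Metric_space M d" "Metric_space.mcomplete M d"
      "P = Metric_space.mtopology M d" "M = topspace P" and c: "\<And>n. c n \<in> M" "P closure_of range c = M"
      using Polish_spaceE[OF P] by metis
    interpret Metric_space M d by (rule Md)
    have c': "mtopology closure_of range c = M" using c(2) Md(3) by simp
    let ?G = "range (\<lambda>n. d (c n))"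
    have borel: "A \<subseteq> M \<and> souslin ?G A \<and> souslin ?G (M - A)" if "A \<in> sets (borel_of P)" for A
      using souslin_borel[OF c(1) c' Md(2)] that Md(3) by simp
    define D where "D = (\<lambda>n. g -` C n \<inter> B)"
    \<comment> \<open>Here the inclusion of the structures enters: \<open>g\<close> is measurable
      into \<open>N'\<close> only, and \<open>C n\<close> is known to be a set of
      \<open>N\<close>.\<close>
    have D: "D n \<in> sets (borel_of P)" for n unfolding D_def using pre C assms(4) by blast
    let ?E = "g -` E \<inter> B"
    have E': "?E \<in> sets (borel_of P)" by (rule pre[OF E])
    have ind: "souslin (range (\<lambda>n. indicator (D n))) A" if "A \<in> sets (borel_of P)" for A
    proof (rule souslin_indicators[of M ?G])
      show "x = y" if "x \<in> M" "y \<in> M" "\<And>h. h \<in> ?G \<Longrightarrow> h x = h y" for x y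
        by (rule dense_seq_separates[OF c(1) c']) (use that in auto)
    qed (use borel that D in auto)
    have "borel_separated B D ?E (B - ?E)"
    proof (rule luzin_separation)
      fix a b assume ab: "a \<in> ?E" "b \<in> B - ?E"
      then have "g a \<noteq> g b" by auto
      moreover have "g a \<in> space N" "g b \<in> space N" using ab gN assms(3) by auto
      ultimately obtain n where "(g a \<in> C n) \<noteq> (g b \<in> C n)" using C(2) by blast
      then show "\<exists>n. (a \<in> D n) \<noteq> (b \<in> D n)" unfolding D_def using ab by (intro exI[of _ n]) auto
    qed (use ind E' B D_def in auto)
    then obtain S where S: "S \<in> sigma_sets B (range D)" "?E \<subseteq> S" "S \<inter> (B - ?E) = {}"
      unfolding borel_separated_def by blast
    \<comment> \<open>Measurability of \<open>f\<close> is known with respect to \<open>N'\<close>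
      only, so the preimages are followed through the generation by \<open>D\<close>. The inclusion
      in \<open>B\<close> is carried along because a set in \<open>B\<close> that misses
      \<open>B - ?E\<close> lies in \<open>?E\<close>.\<close>
    have "f -` A \<inter> space N \<in> sets N \<and> A \<subseteq> B" if "A \<in> sigma_sets B (range D)" for A
      using that
    proof induction
      case (Basic A)
      then obtain n where "A = D n" by blast
      moreover have "f -` D n \<inter> space N = C n"
        using f(2) fB sets.sets_into_space[OF C(1)[of n]] assms(3) unfolding D_def by auto
      ultimately show ?case using C D_def by auto
    next
      case (Compl A)
      have "f -` (B - A) \<inter> space N = space N - (f -` A \<inter> space N)"
        using fB assms(3) by auto
      then show ?case using Compl by auto
    next
      case (Union A)
      have "(\<Union>n. f -` A n \<inter> space N) \<in> sets N" using Union.IH by blast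
      moreover have "f -` (\<Union>n. A n) \<inter> space N = (\<Union>n. f -` A n \<inter> space N)" by blast
      moreover have "(\<Union>n. A n) \<subseteq> B" using Union.IH by blast
      ultimately show ?case by simp
    qed auto
    note fS = this[OF S(1)]
    then have "S = ?E" using S(2,3) by blast
    moreover have "f -` ?E \<inter> space N = E"
      using f(2) fB sets.sets_into_space[OF E] assms(3) by auto
    ultimately show ?thesis using fS by metis
  qed simp
qed

section \<open>Constructions of standard Borel spaces: products and injective pullbacks\<close>

lemma Polish_space_euclidean: "Polish_space (euclidean :: 'a :: polish_space topology)"
proof -
  obtain D :: "'a set" where "countable D" "\<And>X. open X \<Longrightarrow> X \<noteq> {} \<Longrightarrow> \<exists>d\<in>D. d \<in> X"
    using countable_dense_setE by blast
  then have "separable_space (euclidean :: 'a topology)"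
    unfolding separable_space_def by (intro exI[of _ D]) (auto simp: closure_of_def)
  then show ?thesis
    unfolding Polish_space_def using completely_metrizable_space_euclidean by blast
qed

lemma Polish_space_prod_topology:
  assumes "Polish_space S" "Polish_space T"
  shows "Polish_space (prod_topology S T)"
proof -
  obtain A B where "countable A" "A \<subseteq> topspace S" "S closure_of A = topspace S"
    "countable B" "B \<subseteq> topspace T" "T closure_of B = topspace T"
    using assms unfolding Polish_space_def separable_space_def by blast
  then have "separable_space (prod_topology S T)"
    unfolding separable_space_def by (intro exI[of _ "A \<times> B"]) (auto simp: closure_of_Times)
  then show ?thesis using assms unfolding Polish_space_def
    by (simp add: completely_metrizable_space_prod_topology)
qed

lemma Polish_space_imp_second_countable:
  assumes "Polish_space T"
  obtains \<B> where "countable \<B>" "\<And>U. U \<in> \<B> \<Longrightarrow> openin T U"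
    "\<And>U x. openin T U \<Longrightarrow> x \<in> U \<Longrightarrow> \<exists>V\<in>\<B>. x \<in> V \<and> V \<subseteq> U"
proof (cases "topspace T = {}")
  case True
  then show ?thesis using that[of "{}"] openin_subset[of T] by force
next
  case False
  obtain M d and c :: "nat \<Rightarrow> 'a" where Md: "Metric_space M d" "T = Metric_space.mtopology M d"
     and c: "\<And>n. c n \<in> M" "T closure_of range c = M"
    using Polish_spaceE[OF assms False] by metis
  interpret Metric_space M d by (rule Md)
  have c': "mtopology closure_of range c = M" using c(2) Md(2) by simp
  show ?thesis
  proof (rule that[of "small_balls c"])
    show "openin T U" if U: "U \<in> small_balls c" for U
    proof -
      obtain n k where "U = {x \<in> M. d (c n) x < inverse (real (Suc k))}"
        using U unfolding small_balls_def by auto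
      also have "\<dots> = mball (c n) (inverse (real (Suc k)))" using c(1) by auto
      finally show ?thesis using Md(2) by simp
    qed
    show "\<exists>V\<in>small_balls c. x \<in> V \<and> V \<subseteq> U" if "openin T U" "x \<in> U" for U x
      using openin_contains_small_ball[OF c(1) c'] that unfolding Md(2) by blast
  qed (rule countable_small_balls)
qed

text \<open>Allows a Polish model over any type; a homeomorphic copy on the reals is inserted
  between the model and the definition.\<close>

lemma standard_borelI:
  assumes T: "Polish_space T" "B \<in> sets (borel_of T)"
    and f: "f \<in> measurable N (borel_of T)" "\<And>x. x \<in> space N \<Longrightarrow> f x \<in> B" "\<And>x. x \<in> space N \<Longrightarrow> g (f x) = x"
    and g: "g \<in> measurable (restrict_space (borel_of T) B) N" "\<And>y. y \<in> B \<Longrightarrow> f (g y) = y"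
  shows "standard_borel N"
proof -
  obtain P :: "real topology" where P: "Polish_space P" "T homeomorphic_space P"
    using Polish_space_real_copy[OF T(1)] by blast
  then obtain h k where hk: "continuous_map T P h" "continuous_map P T k"
    "\<And>x. x \<in> topspace T \<Longrightarrow> k (h x) = x" "\<And>y. y \<in> topspace P \<Longrightarrow> h (k y) = y"
    unfolding homeomorphic_space_def homeomorphic_maps_def by blast
  note h = measurable_borel_of_continuous[OF hk(1)] and k = measurable_borel_of_continuous[OF hk(2)]
  let ?B = "k -` B \<inter> topspace P"
  have BT: "B \<subseteq> topspace T" using sets.sets_into_space[OF T(2)] by simp
  have hT: "h x \<in> topspace P" if "x \<in> topspace T" for x
    using hk(1) that by (auto simp: continuous_map_def Pi_iff)
  show ?thesis
    unfolding standard_borel_def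
  proof (intro exI conjI ballI)
    show "Polish_space P" by (rule P)
    show "?B \<in> sets (borel_of P)" using measurable_sets[OF k T(2)] by simp
    show "(\<lambda>x. h (f x)) \<in> measurable N (restrict_space (borel_of P) ?B)"
      by (rule measurable_restrict_space2[OF _ measurable_compose[OF f(1) h]])
        (use f(2) BT hk(3) hT in auto)
    have "k \<in> measurable (restrict_space (borel_of P) ?B) (restrict_space (borel_of T) B)"
      by (rule measurable_restrict_space2[OF _ measurable_restrict_space1[OF k]])
        (auto simp: space_restrict_space)
    then show "(\<lambda>y. g (k y)) \<in> measurable (restrict_space (borel_of P) ?B) N"
      using measurable_compose g(1) by blast
    show "g (k (h (f x))) = x" if "x \<in> space N" for x
      using f(2,3)[OF that] hk(3)[of "f x"] BT by auto
    show "h (f (g (k y))) = y" if "y \<in> ?B" for y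
      using g(2)[of "k y"] hk(4)[of y] that by auto
  qed
qed

text \<open>Countable bases of both factors make every open set of the product a countable union of
  open rectangles, so the Borel sets of the product topology already lie in the product
  structure.\<close>

lemma measurable_pair_borel_of:
  assumes S: "Polish_space S" and T: "Polish_space T"
  shows "(\<lambda>z. z) \<in> measurable (borel_of S \<Otimes>\<^sub>M borel_of T) (borel_of (prod_topology S T))"
proof (rule measurable_borel_of)
  obtain \<A> where A: "countable \<A>" "\<And>U. U \<in> \<A> \<Longrightarrow> openin S U"
    "\<And>U x. openin S U \<Longrightarrow> x \<in> U \<Longrightarrow> \<exists>V\<in>\<A>. x \<in> V \<and> V \<subseteq> U"
    using Polish_space_imp_second_countable[OF S] by metis
  obtain \<B> where B: "countable \<B>" "\<And>U. U \<in> \<B> \<Longrightarrow> openin T U"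
    "\<And>U x. openin T U \<Longrightarrow> x \<in> U \<Longrightarrow> \<exists>V\<in>\<B>. x \<in> V \<and> V \<subseteq> U"
    using Polish_space_imp_second_countable[OF T] by metis
  fix W assume W: "openin (prod_topology S T) W"
  let ?I = "{(U, V) \<in> \<A> \<times> \<B>. U \<times> V \<subseteq> W}"
  have "W = (\<Union>(U, V)\<in>?I. U \<times> V)"
  proof (intro equalityI subsetI)
    fix z assume z: "z \<in> W"
    then obtain U V where "openin S U" "openin T V" "z \<in> U \<times> V" "U \<times> V \<subseteq> W"
      using W unfolding openin_prod_topology_alt by (metis SigmaI surj_pair)
    moreover from this obtain U' V' where "U' \<in> \<A>" "fst z \<in> U'" "U' \<subseteq> U" "V' \<in> \<B>" "snd z \<in> V'" "V' \<subseteq> V"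
      using A(3)[of U "fst z"] B(3)[of V "snd z"] by auto
    ultimately have "(U', V') \<in> ?I" "z \<in> U' \<times> V'" by auto
    then show "z \<in> (\<Union>(U, V)\<in>?I. U \<times> V)" by blast
  qed auto
  moreover have "(\<Union>(U, V)\<in>?I. U \<times> V) \<in> sets (borel_of S \<Otimes>\<^sub>M borel_of T)"
  proof (rule sets.countable_UN')
    show "countable ?I" by (rule countable_subset[of _ "\<A> \<times> \<B>"]) (use A B in auto)
    show "(\<lambda>(U, V). U \<times> V) ` ?I \<subseteq> sets (borel_of S \<Otimes>\<^sub>M borel_of T)"
      using A(2) B(2) by (auto intro!: pair_measureI borel_of_open)
  qed
  moreover have "W \<subseteq> topspace S \<times> topspace T" using openin_subset[OF W] by simp
  ultimately show "(\<lambda>z. z) -` W \<inter> space (borel_of S \<Otimes>\<^sub>M borel_of T) \<in> sets (borel_of S \<Otimes>\<^sub>M borel_of T)"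
    by (simp add: space_pair_measure Int_absorb2)
qed (auto simp: space_pair_measure)

lemma standard_borel_pair_borel:
  assumes "standard_borel X"
  shows "standard_borel (X \<Otimes>\<^sub>M (borel :: 'b :: polish_space measure))"
proof -
  obtain P :: "real topology" and B f g where P: "Polish_space P" and B: "B \<in> sets (borel_of P)"
    and f: "f \<in> measurable X (restrict_space (borel_of P) B)" "\<And>x. x \<in> space X \<Longrightarrow> g (f x) = x"
    and g: "g \<in> measurable (restrict_space (borel_of P) B) X" "\<And>y. y \<in> B \<Longrightarrow> f (g y) = y"
    using assms unfolding standard_borel_def by blast
  let ?Q = "prod_topology P (euclidean :: 'b topology)"
  have BP: "B \<subseteq> topspace P" using sets.sets_into_space[OF B] by simp
  have id: "(\<lambda>x. x) \<in> measurable borel (borel_of (euclidean :: 'b topology))"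
      "(\<lambda>x. x) \<in> measurable (borel_of (euclidean :: 'b topology)) borel"
    using sets_borel_of_euclidean by (auto simp: measurable_def)
  have f': "f \<in> measurable X (borel_of P)" "\<And>x. x \<in> space X \<Longrightarrow> f x \<in> B"
    using f(1) by (auto simp: measurable_restrict_space2_iff)
  have [measurable]: "fst \<in> measurable (borel_of ?Q) (borel_of P)"
    "snd \<in> measurable (borel_of ?Q) (borel_of (euclidean :: 'b topology))"
    by (rule measurable_borel_of_continuous, rule continuous_map_fst)
      (rule measurable_borel_of_continuous, rule continuous_map_snd)
  show ?thesis
  proof (rule standard_borelI[of ?Q "B \<times> UNIV" "\<lambda>(x, a). (f x, a)" _ "\<lambda>(y, a). (g y, a)"])
    show "Polish_space ?Q" using P Polish_space_euclidean by (rule Polish_space_prod_topology)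
    have "fst -` B \<inter> space (borel_of ?Q) \<in> sets (borel_of ?Q)" using B by measurable
    moreover have "fst -` B \<inter> space (borel_of ?Q) = B \<times> UNIV" using BP by auto
    ultimately show "B \<times> UNIV \<in> sets (borel_of ?Q)" by simp
    have "(\<lambda>z. (f (fst z), snd z)) \<in> measurable (X \<Otimes>\<^sub>M borel) (borel_of P \<Otimes>\<^sub>M borel_of (euclidean :: 'b topology))"
      using measurable_compose[OF measurable_fst f'(1)] measurable_compose[OF measurable_snd id(1)]
      by (intro measurable_Pair) auto
    from measurable_compose[OF this measurable_pair_borel_of[OF P Polish_space_euclidean]]
    show "(\<lambda>(x, a). (f x, a)) \<in> measurable (X \<Otimes>\<^sub>M borel) (borel_of ?Q)"
      by (simp add: case_prod_unfold)
    let ?R = "restrict_space (borel_of ?Q) (B \<times> UNIV)"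
    have "fst \<in> measurable ?R (restrict_space (borel_of P) B)"
      by (intro measurable_restrict_space2 measurable_restrict_space1)
        (auto simp: space_restrict_space)
    moreover have "snd \<in> measurable ?R borel"
      using measurable_compose[OF measurable_restrict_space1 id(2)] by measurable
    ultimately have "(\<lambda>z. (g (fst z), snd z)) \<in> measurable ?R (X \<Otimes>\<^sub>M borel)"
      using measurable_compose[OF _ g(1)] by (intro measurable_Pair) auto
    then show "(\<lambda>(y, a). (g y, a)) \<in> measurable ?R (X \<Otimes>\<^sub>M borel)"
      by (simp add: case_prod_unfold)
  qed (use f' f g in \<open>auto simp: space_pair_measure\<close>)
qed

lemma standard_borel_vimage_algebra:
  assumes "standard_borel Z" "inj_on h C" "h ` C \<in> sets Z"
  shows "standard_borel (vimage_algebra C h Z)"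
proof -
  obtain P :: "real topology" and B f g where P: "Polish_space P" and B: "B \<in> sets (borel_of P)"
    and f: "f \<in> measurable Z (restrict_space (borel_of P) B)" "\<And>x. x \<in> space Z \<Longrightarrow> g (f x) = x"
    and g: "g \<in> measurable (restrict_space (borel_of P) B) Z" "\<And>y. y \<in> B \<Longrightarrow> f (g y) = y"
    using assms unfolding standard_borel_def by blast
  have BP: "B \<subseteq> topspace P" using sets.sets_into_space[OF B] by simp
  have f': "f \<in> measurable Z (borel_of P)" "\<And>x. x \<in> space Z \<Longrightarrow> f x \<in> B"
    using f(1) by (auto simp: measurable_restrict_space2_iff)
  have hZ: "h ` C \<subseteq> space Z" by (rule sets.sets_into_space[OF assms(3)])
  have spR: "space (restrict_space (borel_of P) B) = B" using BP by (auto simp: space_restrict_space)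
  have h: "h \<in> measurable (vimage_algebra C h Z) Z"
    by (rule measurable_vimage_algebra1) (use hZ in auto)
  let ?B = "g -` (h ` C) \<inter> B"
  have inv: "h (inv_into C h z) = z \<and> inv_into C h z \<in> C" if "z \<in> h ` C" for z
    using that by (simp add: f_inv_into_f inv_into_into)
  show ?thesis
  proof (rule standard_borelI[of P ?B "\<lambda>x. f (h x)" _ "\<lambda>y. inv_into C h (g y)"])
    show "Polish_space P" by (rule P)
    have "g -` (h ` C) \<inter> space (restrict_space (borel_of P) B) \<in> sets (restrict_space (borel_of P) B)"
      by (rule measurable_sets[OF g(1) assms(3)])
    then show "?B \<in> sets (borel_of P)" using B spR by (auto simp: sets_restrict_space)
    show "(\<lambda>x. f (h x)) \<in> measurable (vimage_algebra C h Z) (borel_of P)"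
      by (rule measurable_compose[OF h f'(1)])
    have g': "g \<in> measurable (restrict_space (borel_of P) ?B) Z"
    proof -
      have "(\<lambda>y. y) \<in> measurable (restrict_space (borel_of P) ?B) (restrict_space (borel_of P) B)"
        by (intro measurable_restrict_space2 measurable_restrict_space1 measurable_ident_sets refl)
          (auto simp: space_restrict_space)
      then show ?thesis using measurable_compose g(1) by blast
    qed
    show "(\<lambda>y. inv_into C h (g y)) \<in> measurable (restrict_space (borel_of P) ?B) (vimage_algebra C h Z)"
    proof (rule measurable_vimage_algebra2)
      show "(\<lambda>y. inv_into C h (g y)) \<in> space (restrict_space (borel_of P) ?B) \<rightarrow> C"
        using inv by (auto simp: space_restrict_space)
      have "h (inv_into C h (g y)) = g y" if "y \<in> space (restrict_space (borel_of P) ?B)" for y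
        using that inv by (simp add: space_restrict_space)
      then show "(\<lambda>x. h (inv_into C h (g x))) \<in> measurable (restrict_space (borel_of P) ?B) Z"
        using g' by (simp cong: measurable_cong)
    qed
  qed (use f' f g inv hZ assms(2) in \<open>auto simp: space_vimage_algebra inv_into_f_f\<close>)
qed

section \<open>Compact exhaustion in terms of a dense sequence\<close>

text \<open>
  Here \<open>D i j\<close> is the distance of the \<open>i\<close>-th and the \<open>j\<close>-th point of a dense sequence. In a complete space the
  condition says that the ball of radius \<open>1 / (k + 1)\<close> around the \<open>n\<close>-th point is relatively compact.
\<close>

definition totally_bounded_ball :: "(nat \<Rightarrow> nat \<Rightarrow> real) \<Rightarrow> nat \<Rightarrow> nat \<Rightarrow> bool" where
  "totally_bounded_ball D n k \<longleftrightarrow>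
    (\<forall>j. \<exists>m. \<forall>i. D i n < inverse (real (Suc k)) \<longrightarrow> (\<exists>l\<le>m. D i l < inverse (real (Suc j))))"

text \<open>Bounding both \<open>n\<close> and \<open>k\<close> by \<open>p\<close> admits only
  finitely many balls, so the points selected form a totally bounded set, and the sets increase with
  \<open>p\<close>.\<close>

definition core_indices :: "(nat \<Rightarrow> nat \<Rightarrow> real) \<Rightarrow> nat \<Rightarrow> nat set" where
  "core_indices D p =
    {i. \<exists>n\<le>p. \<exists>k\<le>p. totally_bounded_ball D n k \<and> D i n < inverse (real (Suc k))}"

text \<open>Uniform continuity with reciprocals of positive integers in place of real bounds: all
  quantifiers are countable, which makes the condition measurable in \<open>D\<close> and
  \<open>a\<close>.\<close>

definition core_uniform :: "(nat \<Rightarrow> nat \<Rightarrow> real) \<Rightarrow> (nat \<Rightarrow> 'b :: metric_space) \<Rightarrow> bool" where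
  "core_uniform D a \<longleftrightarrow>
    (\<forall>p e. \<exists>m. \<forall>i j. i \<in> core_indices D p \<longrightarrow> j \<in> core_indices D p \<longrightarrow>
      D i j < inverse (real (Suc m)) \<longrightarrow> dist (a i) (a j) < inverse (real (Suc e)))"

lemma core_indices_mono: "p \<le> q \<Longrightarrow> core_indices D p \<subseteq> core_indices D q"
  unfolding core_indices_def by (blast intro: order_trans)

locale locally_compact_Polish_metric = Metric_space W d
  for W :: "'v set" and d :: "'v \<Rightarrow> 'v \<Rightarrow> real" +
  fixes c :: "nat \<Rightarrow> 'v"
  assumes c_in: "c n \<in> W"
    and c_dense: "mtopology closure_of range c = W"
    and complete: mcomplete
    and locally_compact: "locally_compact_space mtopology"
begin

abbreviation D :: "nat \<Rightarrow> nat \<Rightarrow> real" where "D i j \<equiv> d (c i) (c j)"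

definition core :: "nat \<Rightarrow> 'v set" where
  "core p = mtopology closure_of (c ` core_indices D p)"

lemma approx:
  assumes "v \<in> W" "e > 0"
  obtains n where "d v (c n) < e"
proof -
  have "v \<in> mtopology closure_of range c" using assms c_dense by simp
  then show ?thesis using assms that unfolding metric_closure_of by auto
qed

lemma continuous_map_metric_iff:
  fixes F :: "'v \<Rightarrow> 'b :: metric_space"
  shows "continuous_map mtopology euclidean F \<longleftrightarrow>
    (\<forall>v\<in>W. \<forall>e>0. \<exists>r>0. \<forall>w\<in>W. d v w < r \<longrightarrow> dist (F v) (F w) < e)"
  using metric_continuous_map[OF Met_TC.Metric_space_axioms, of F] by (simp add: Ball_def imp_conjL)

lemma core_mono: "p \<le> q \<Longrightarrow> core p \<subseteq> core q"
  unfolding core_def by (intro closure_of_mono image_mono core_indices_mono)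

lemma core_subset: "core p \<subseteq> W"
  unfolding core_def using closure_of_subset_topspace[of mtopology] by simp

lemma c_in_core: "i \<in> core_indices D p \<Longrightarrow> c i \<in> core p"
  unfolding core_def by (rule closure_of_subset[THEN subsetD]) (auto simp: c_in)

text \<open>Every ball of radius \<open>e / 2\<close> that meets \<open>S\<close> lies in the ball
  of radius \<open>e\<close> around any of its points in \<open>S\<close>, so the centres can be
  moved into \<open>S\<close>. The nets coming from \<open>totally_bounded_ball\<close> may have
  centres outside the ball in question.\<close>

lemma mtotally_bounded_external:
  assumes SW: "S \<subseteq> W"
    and net: "\<And>e. e > 0 \<Longrightarrow> \<exists>K. finite K \<and> K \<subseteq> W \<and> S \<subseteq> (\<Union>x\<in>K. mball x e)"
  shows "mtotally_bounded S"
  unfolding mtotally_bounded_def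
proof (intro allI impI)
  fix e :: real assume "e > 0"
  then obtain K where K: "finite K" "K \<subseteq> W" "S \<subseteq> (\<Union>x\<in>K. mball x (e / 2))"
    using net[of "e / 2"] by auto
  define K' where "K' = {x \<in> K. S \<inter> mball x (e / 2) \<noteq> {}}"
  have "\<exists>y. y \<in> S \<inter> mball x (e / 2)" if "x \<in> K'" for x using that unfolding K'_def by blast
  then obtain f where f: "\<And>x. x \<in> K' \<Longrightarrow> f x \<in> S \<inter> mball x (e / 2)" by metis
  have "S \<subseteq> (\<Union>x\<in>f ` K'. mball x e)"
  proof
    fix y assume y: "y \<in> S"
    then obtain x where x: "x \<in> K" "y \<in> mball x (e / 2)" using K(3) by blast
    then have xK: "x \<in> K'" unfolding K'_def using y by blast
    have "d (f x) y < e"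
      using f[OF xK] x(2) triangle''[of "f x" x y] by auto
    then show "y \<in> (\<Union>x\<in>f ` K'. mball x e)"
      using f[OF xK] x xK by (intro UN_I[of "f x"]) auto
  qed
  moreover have "finite (f ` K')" unfolding K'_def using K(1) by simp
  moreover have "f ` K' \<subseteq> S" using f by blast
  ultimately show "\<exists>K. finite K \<and> K \<subseteq> S \<and> S \<subseteq> (\<Union>x\<in>K. mball x e)" by blast
qed

text \<open>The points involved form a finite union of totally bounded sets, and completeness makes
  the closure of a totally bounded set compact.\<close>

lemma compactin_core: "compactin mtopology (core p)"
proof -
  define S where "S = (\<lambda>n k. {c i | i. totally_bounded_ball D n k \<and> D i n < inverse (real (Suc k))})"
  have S: "mtotally_bounded (S n k)" for n k
  proof (rule mtotally_bounded_external)
    show "S n k \<subseteq> W" unfolding S_def using c_in by blast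
    fix e :: real assume "e > 0"
    then obtain j where j: "inverse (real (Suc j)) < e" using reals_Archimedean by blast
    show "\<exists>K. finite K \<and> K \<subseteq> W \<and> S n k \<subseteq> (\<Union>x\<in>K. mball x e)"
    proof (cases "totally_bounded_ball D n k")
      case True
      then obtain m where m: "\<And>i. D i n < inverse (real (Suc k)) \<Longrightarrow> \<exists>l\<le>m. D i l < inverse (real (Suc j))"
        unfolding totally_bounded_ball_def by blast
      have "S n k \<subseteq> (\<Union>x\<in>c ` {..m}. mball x e)"
      proof
        fix x assume "x \<in> S n k"
        then obtain i where i: "x = c i" "D i n < inverse (real (Suc k))" unfolding S_def by blast
        obtain l where "l \<le> m" "D i l < inverse (real (Suc j))" using m[OF i(2)] by blast
        then show "x \<in> (\<Union>x\<in>c ` {..m}. mball x e)"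
          using i(1) j c_in by (intro UN_I[of "c l"]) (auto simp: commute)
      qed
      then show ?thesis using c_in by (intro exI[of _ "c ` {..m}"]) auto
    next
      case False
      then show ?thesis unfolding S_def by (intro exI[of _ "{}"]) auto
    qed
  qed
  have "mtotally_bounded (\<Union>((\<lambda>(n, k). S n k) ` ({..p} \<times> {..p})))"
    by (rule mtotally_bounded_Union) (use S in auto)
  moreover have "c ` core_indices D p = \<Union>((\<lambda>(n, k). S n k) ` ({..p} \<times> {..p}))"
    unfolding core_indices_def S_def by auto
  ultimately show ?thesis
    unfolding core_def using mtotally_bounded_eq_compact_closure_of[OF complete] by simp
qed

text \<open>A finite net of \<open>C\<close> is replaced by nearby points of the dense sequence at
  the cost of doubling the radius; the largest index used is the bound \<open>m\<close>.\<close>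

lemma totally_bounded_ballI:
  assumes C: "compactin mtopology C"
    and sub: "\<And>i. D i n < inverse (real (Suc k)) \<Longrightarrow> c i \<in> C"
  shows "totally_bounded_ball D n k"
  unfolding totally_bounded_ball_def
proof
  fix j
  let ?e = "inverse (real (Suc j))"
  have "mtotally_bounded C" by (rule compactin_imp_mtotally_bounded[OF C])
  then obtain K where K: "finite K" "K \<subseteq> C" "C \<subseteq> (\<Union>x\<in>K. mball x (?e / 2))"
    unfolding mtotally_bounded_def by (metis half_gt_zero inverse_positive_iff_positive of_nat_0_less_iff zero_less_Suc)
  have KW: "K \<subseteq> W" using K(2) compactin_subset_topspace[OF C] by simp
  have "\<exists>l. d x (c l) < ?e / 2" if "x \<in> K" for x
    using approx[of x "?e / 2"] that KW by auto
  then obtain l where l: "\<And>x. x \<in> K \<Longrightarrow> d x (c (l x)) < ?e / 2" by metis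
  obtain m where m: "\<And>x. x \<in> K \<Longrightarrow> l x \<le> m"
    using finite_nat_set_iff_bounded_le[of "l ` K"] K(1) by auto
  have "\<exists>l\<le>m. D i l < ?e" if i: "D i n < inverse (real (Suc k))" for i
  proof -
    obtain x where x: "x \<in> K" "d x (c i) < ?e / 2" using K(3) sub[OF i] by auto
    have "D i (l x) < ?e"
      using triangle''[of "c i" x "c (l x)"] x l[OF x(1)] c_in KW by fastforce
    then show ?thesis using m[OF x(1)] by blast
  qed
  then show "\<exists>m. \<forall>i. D i n < inverse (real (Suc k)) \<longrightarrow> (\<exists>l\<le>m. D i l < ?e)" by blast
qed

text \<open>This is where local compactness enters. A sample point \<open>c n\<close> very close to
  \<open>v\<close> has a ball inside a compact neighbourhood of \<open>v\<close>, so that ball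
  passes the countable test, and it still contains a ball around \<open>v\<close>.\<close>

lemma core_nbhd:
  assumes v: "v \<in> W"
  obtains p r where "r > 0" "\<And>i. d v (c i) < r \<Longrightarrow> i \<in> core_indices D p" "mball v r \<subseteq> core p"
proof -
  obtain U C where UC: "openin mtopology U" "compactin mtopology C" "v \<in> U" "U \<subseteq> C"
    using locally_compact v unfolding locally_compact_space_def by auto
  obtain r where r: "r > 0" "mball v r \<subseteq> C" using UC unfolding openin_mtopology by blast
  obtain k where k: "inverse (real (Suc k)) < r / 2" using reals_Archimedean r by (metis half_gt_zero)
  let ?k = "inverse (real (Suc k))"
  obtain n where n: "d v (c n) < ?k" using approx[OF v, of ?k] by auto
  have "c i \<in> C" if "D i n < ?k" for i
  proof -
    have "d v (c i) < r"
      using triangle'[OF v c_in c_in, of i n] that n k by linarith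
    then show ?thesis using r v c_in by auto
  qed
  then have tb: "totally_bounded_ball D n k" by (rule totally_bounded_ballI[OF UC(2)])
  \<comment> \<open>The slack left by the triangle inequality: a ball of radius \<open>s\<close>
    around \<open>v\<close> lies in the ball of radius \<open>?k\<close> around
    \<open>c n\<close>.\<close>
  define s where "s = ?k - d v (c n)"
  have i: "i \<in> core_indices D (max n k)" if "d v (c i) < s" for i
  proof -
    have "D i n < ?k" using triangle''[OF c_in v c_in, of i n] that s_def by linarith
    then show ?thesis
      unfolding core_indices_def using tb max.cobounded1[of n k] max.cobounded2[of k n] by blast
  qed
  show ?thesis
  proof (rule that[of s "max n k"])
    show "s > 0" using n s_def by simp
    show "\<And>i. d v (c i) < s \<Longrightarrow> i \<in> core_indices D (max n k)" by (rule i)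
    show "mball v s \<subseteq> core (max n k)"
    proof
      fix w assume w: "w \<in> mball v s"
      show "w \<in> core (max n k)"
        unfolding core_def metric_closure_of
      proof (intro CollectI conjI allI impI)
        show wW: "w \<in> W" using w by simp
        fix e :: real assume "e > 0"
        \<comment> \<open>The second term of the minimum keeps \<open>c j\<close> within
          \<open>s\<close> of \<open>v\<close>, so that its index is a core index.\<close>
        then obtain j where j: "d w (c j) < min e (s - d v w)" using approx[OF wW, of "min e (s - d v w)"] w by auto
        have "d v (c j) < s" using triangle[OF v wW c_in, of j] j by linarith
        then show "\<exists>y\<in>c ` core_indices D (max n k). y \<in> mball w e"
          using i j wW c_in by (intro bexI[of _ "c j"]) auto
      qed
    qed
  qed
qed

lemma compactin_finite_subcover:
  assumes "compactin mtopology C" "\<And>x. x \<in> C \<Longrightarrow> r x > 0"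
  obtains A where "finite A" "A \<subseteq> C" "C \<subseteq> (\<Union>x\<in>A. mball x (r x))"
proof -
  have CW: "C \<subseteq> W" using compactin_subset_topspace[OF assms(1)] by simp
  obtain \<F> where F: "finite \<F>" "\<F> \<subseteq> (\<lambda>x. mball x (r x)) ` C" "C \<subseteq> \<Union>\<F>"
  proof -
    have "openin mtopology U" if "U \<in> (\<lambda>x. mball x (r x)) ` C" for U using that by auto
    moreover have "C \<subseteq> \<Union>((\<lambda>x. mball x (r x)) ` C)" using assms(2) CW by auto
    ultimately show ?thesis using that compactinD[OF assms(1)] by metis
  qed
  obtain A where "A \<subseteq> C" "finite A" "\<F> = (\<lambda>x. mball x (r x)) ` A"
    using finite_subset_image[OF F(1,2)] by blast
  then show ?thesis using that[of A] F(3) by simp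
qed

lemma compactin_subset_core:
  assumes "compactin mtopology C"
  obtains p where "C \<subseteq> core p"
proof -
  have CW: "C \<subseteq> W" using compactin_subset_topspace[OF assms] by simp
  have "\<exists>p r. r > 0 \<and> mball x r \<subseteq> core p" if "x \<in> C" for x
  proof (rule core_nbhd[of x])
    show "x \<in> W" using that CW by blast
    show "\<exists>p r. r > 0 \<and> mball x r \<subseteq> core p" if "r > 0" "mball x r \<subseteq> core p" for p r
      using that by blast
  qed
  then obtain p r where pr: "\<And>x. x \<in> C \<Longrightarrow> r x > 0 \<and> mball x (r x) \<subseteq> core (p x)" by metis
  obtain A where A: "finite A" "A \<subseteq> C" "C \<subseteq> (\<Union>x\<in>A. mball x (r x))"
    by (rule compactin_finite_subcover[OF assms, of r]) (use pr in auto)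
  obtain m where m: "\<And>x. x \<in> A \<Longrightarrow> p x \<le> m"
    using finite_nat_set_iff_bounded_le[of "p ` A"] A(1) by auto
  have "mball x (r x) \<subseteq> core m" if "x \<in> A" for x
    using pr[of x] core_mono[OF m[OF that]] that A(2) by (meson in_mono subset_trans)
  then have "(\<Union>x\<in>A. mball x (r x)) \<subseteq> core m" by (rule UN_least)
  then show ?thesis using that[of m] A(3) by simp
qed

text \<open>More than uniform continuity on \<open>C\<close>, since only one of the two points has
  to lie in \<open>C\<close>. The approximation by bump averages compares points of a core with
  sample points that may lie outside it.\<close>

lemma continuous_map_uniform_near_compact:
  fixes F :: "'v \<Rightarrow> 'b :: metric_space"
  assumes C: "compactin mtopology C" and F: "continuous_map mtopology euclidean F" and "e > 0"
  obtains r where "r > 0" "\<And>x w. x \<in> C \<Longrightarrow> w \<in> W \<Longrightarrow> d x w < r \<Longrightarrow> dist (F x) (F w) < e"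
proof -
  have CW: "C \<subseteq> W" using compactin_subset_topspace[OF C] by simp
  have "\<exists>r>0. \<forall>w\<in>W. d x w < r \<longrightarrow> dist (F x) (F w) < e / 2" if "x \<in> W" for x
    using F \<open>e > 0\<close> that unfolding continuous_map_metric_iff by (meson half_gt_zero)
  then obtain r where r: "\<And>x. x \<in> W \<Longrightarrow> r x > 0"
    "\<And>x w. x \<in> W \<Longrightarrow> w \<in> W \<Longrightarrow> d x w < r x \<Longrightarrow> dist (F x) (F w) < e / 2" by metis
  have "r x / 2 > 0" if "x \<in> C" for x using r(1) CW that by auto
  then obtain A where A: "finite A" "A \<subseteq> C" "C \<subseteq> (\<Union>x\<in>A. mball x (r x / 2))"
    using compactin_finite_subcover[OF C, of "\<lambda>x. r x / 2"] by blast
  \<comment> \<open>Inserting 1 keeps the minimum meaningful when \<open>A\<close> is empty.\<close>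
  define s where "s = Min (insert 1 ((\<lambda>x. r x / 2) ` A))"
  have "s > 0" unfolding s_def using A r(1) CW by (subst Min_gr_iff) auto
  moreover have "dist (F x) (F w) < e" if x: "x \<in> C" and w: "w \<in> W" and xw: "d x w < s" for x w
  proof -
    obtain y where y: "y \<in> A" "d y x < r y / 2" using A(3) x by auto
    have yW: "y \<in> W" and xW: "x \<in> W" using y A(2) CW x by auto
    have "s \<le> r y / 2" unfolding s_def using y A(1) by (intro Min_le) auto
    then have "d y w < r y" using triangle[OF yW xW w] y xw by linarith
    then have "dist (F y) (F w) < e / 2" by (rule r(2)[OF yW w])
    moreover have "d y x < r y" using y nonneg[of y x] by linarith
    then have "dist (F y) (F x) < e / 2" by (rule r(2)[OF yW xW])
    ultimately show ?thesis using dist_triangle3[of "F x" "F w" "F y"] by linarith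
  qed
  ultimately show ?thesis by (rule that)
qed

lemma core_uniform_continuous:
  fixes F :: "'v \<Rightarrow> 'b :: metric_space"
  assumes "continuous_map mtopology euclidean F"
  shows "core_uniform D (\<lambda>i. F (c i))"
  unfolding core_uniform_def
proof (intro allI)
  fix p e
  obtain r where r: "r > 0"
    "\<And>x w. x \<in> core p \<Longrightarrow> w \<in> W \<Longrightarrow> d x w < r \<Longrightarrow> dist (F x) (F w) < inverse (real (Suc e))"
    using continuous_map_uniform_near_compact[OF compactin_core assms, of "inverse (real (Suc e))" p]
    by auto
  obtain m where "inverse (real (Suc m)) < r" using reals_Archimedean r(1) by blast
  then show "\<exists>m. \<forall>i j. i \<in> core_indices D p \<longrightarrow> j \<in> core_indices D p \<longrightarrow>
      D i j < inverse (real (Suc m)) \<longrightarrow> dist (F (c i)) (F (c j)) < inverse (real (Suc e))"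
    using r(2) c_in c_in_core by (intro exI[of _ m]) (meson less_trans)
qed

text \<open>Near any point all sample points belong to one core, so uniform continuity on cores
  makes the values \<open>a i\<close> Cauchy as \<open>c i\<close> approaches the point.
  Completeness of the target then gives the value of \<open>F\<close>.\<close>

lemma continuous_extension:
  fixes a :: "nat \<Rightarrow> 'b :: complete_space"
  assumes "core_uniform D a"
  obtains F where "continuous_map mtopology euclidean F" "\<And>i. F (c i) = a i"
proof -
  have local: "\<exists>r>0. \<forall>i j. d v (c i) < r \<longrightarrow> d v (c j) < r \<longrightarrow> dist (a i) (a j) < e"
    if v: "v \<in> W" and e: "e > 0" for v e
  proof -
    obtain p r where r: "r > 0" "\<And>i. d v (c i) < r \<Longrightarrow> i \<in> core_indices D p"
      using core_nbhd[OF v] by metis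
    obtain k where k: "inverse (real (Suc k)) < e" using reals_Archimedean e by blast
    obtain m where m: "\<And>i j. i \<in> core_indices D p \<Longrightarrow> j \<in> core_indices D p \<Longrightarrow>
      D i j < inverse (real (Suc m)) \<Longrightarrow> dist (a i) (a j) < inverse (real (Suc k))"
      using assms unfolding core_uniform_def by meson
    define s where "s = min r (inverse (real (Suc m)) / 2)"
    have "dist (a i) (a j) < e" if "d v (c i) < s" "d v (c j) < s" for i j
    proof -
      have "D i j < inverse (real (Suc m))"
        using triangle''[OF c_in v c_in, of i j] that unfolding s_def by linarith
      then have "dist (a i) (a j) < inverse (real (Suc k))"
        using m r(2) that unfolding s_def by simp
      then show ?thesis using k by linarith
    qed
    moreover have "s > 0" unfolding s_def using r by simp
    ultimately show ?thesis by blast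
  qed
  have "\<exists>i. d v (c i) < inverse (real (Suc k))" if "v \<in> W" for v k
    using approx[OF that, of "inverse (real (Suc k))"] by auto
  then obtain s where s: "\<And>v k. v \<in> W \<Longrightarrow> d v (c (s v k)) < inverse (real (Suc k))" by metis
  have near: "\<exists>N. \<forall>k\<ge>N. d v (c (s v k)) < r" if "v \<in> W" "r > 0" for v r
  proof -
    obtain N where N: "inverse (real (Suc N)) < r" using reals_Archimedean \<open>r > 0\<close> by blast
    have "d v (c (s v k)) < r" if "k \<ge> N" for k
    proof -
      have "inverse (real (Suc k)) \<le> inverse (real (Suc N))" using that by (simp add: le_imp_inverse_le)
      then show ?thesis using s[OF \<open>v \<in> W\<close>, of k] N by linarith
    qed
    then show ?thesis by blast
  qed
  have "convergent (\<lambda>k. a (s v k))" if v: "v \<in> W" for v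
  proof (rule Cauchy_convergent, rule metric_CauchyI)
    fix e :: real assume "e > 0"
    then obtain r where r: "r > 0" "\<And>i j. d v (c i) < r \<Longrightarrow> d v (c j) < r \<Longrightarrow> dist (a i) (a j) < e"
      using local[OF v] by metis
    obtain N where "\<And>k. k \<ge> N \<Longrightarrow> d v (c (s v k)) < r" using near[OF v r(1)] by blast
    then show "\<exists>M. \<forall>m\<ge>M. \<forall>n\<ge>M. dist (a (s v m)) (a (s v n)) < e"
      using r(2) by (intro exI[of _ N]) simp
  qed
  then have "\<forall>v. \<exists>l. v \<in> W \<longrightarrow> (\<lambda>k. a (s v k)) \<longlonglongrightarrow> l" unfolding convergent_def by blast
  then obtain F where F: "\<And>v. v \<in> W \<Longrightarrow> (\<lambda>k. a (s v k)) \<longlonglongrightarrow> F v" by metis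
  \<comment> \<open>Passing to the limit compares \<open>F v\<close> with every sample value near
    \<open>v\<close>, not only with those chosen to define it. Both continuity and
    \<open>F (c i) = a i\<close> rest on this.\<close>
  have bound: "dist (F v) (a i) \<le> e"
    if v: "v \<in> W" and r: "r > 0" "\<And>i j. d v (c i) < r \<Longrightarrow> d v (c j) < r \<Longrightarrow> dist (a i) (a j) < e"
      and i: "d v (c i) < r" for v r e i
  proof (rule tendsto_upperbound)
    show "(\<lambda>k. dist (a (s v k)) (a i)) \<longlonglongrightarrow> dist (F v) (a i)"
      by (intro tendsto_dist F[OF v] tendsto_const)
    obtain N where "\<And>k. k \<ge> N \<Longrightarrow> d v (c (s v k)) < r" using near[OF v r(1)] by blast
    then show "\<forall>\<^sub>F k in sequentially. dist (a (s v k)) (a i) \<le> e"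
      using r(2) i unfolding eventually_sequentially by (intro exI[of _ N]) (simp add: less_imp_le)
  qed simp
  have "continuous_map mtopology euclidean F"
    unfolding continuous_map_metric_iff
  proof (intro ballI allI impI)
    fix v e assume v: "v \<in> W" and e: "(e :: real) > 0"
    then obtain r where r: "r > 0" "\<And>i j. d v (c i) < r \<Longrightarrow> d v (c j) < r \<Longrightarrow> dist (a i) (a j) < e / 3"
      using local[OF v, of "e / 3"] by auto
    have "dist (F v) (F w) < e" if w: "w \<in> W" "d v w < r" for w
    proof -
      obtain t where t: "t > 0" "\<And>i j. d w (c i) < t \<Longrightarrow> d w (c j) < t \<Longrightarrow> dist (a i) (a j) < e / 3"
        using local[OF w(1), of "e / 3"] e by auto
      \<comment> \<open>One sample point close to \<open>w\<close> and still within \<open>r\<close>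
        of \<open>v\<close> serves as the link between \<open>F v\<close> and
        \<open>F w\<close>.\<close>
      obtain i where i: "d w (c i) < min t (r - d v w)"
        using approx[OF w(1), of "min t (r - d v w)"] t w by auto
      have "d v (c i) < r" using triangle[OF v w(1) c_in, of i] i by linarith
      then have "dist (F v) (a i) \<le> e / 3" using bound[OF v r] by blast
      moreover have "dist (F w) (a i) \<le> e / 3" using bound[OF w(1) t, of i] i by auto
      ultimately show ?thesis using dist_triangle2[of "F v" "F w" "a i"] e by linarith
    qed
    then show "\<exists>r>0. \<forall>w\<in>W. d v w < r \<longrightarrow> dist (F v) (F w) < e" using r(1) by blast
  qed
  moreover have "F (c i) = a i" for i
  proof (rule ccontr)
    assume "F (c i) \<noteq> a i"
    then have e: "dist (F (c i)) (a i) / 2 > 0" by simp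
    obtain r where r: "r > 0" "\<And>k j. D i k < r \<Longrightarrow> D i j < r \<Longrightarrow> dist (a k) (a j) < dist (F (c i)) (a i) / 2"
      using local[OF c_in e] by metis
    have "D i i < r" using r(1) c_in by simp
    then show False using bound[OF c_in r] e by force
  qed
  ultimately show ?thesis by (rule that)
qed

end

section \<open>The compact-open topology\<close>

text \<open>
  The truncation at \<open>1 / (p + 1)\<close> makes a single supremum metrise uniform convergence on every \<open>I p\<close>,
  for an increasing sequence \<open>I\<close> of index sets.
\<close>

definition core_term :: "(nat \<Rightarrow> nat set) \<Rightarrow> (nat \<Rightarrow> 'b :: metric_space) \<Rightarrow> (nat \<Rightarrow> 'b) \<Rightarrow> nat \<times> nat \<Rightarrow> real" where
  "core_term I a b = (\<lambda>(p, i). if i \<in> I p then min (inverse (real (Suc p))) (dist (a i) (b i)) else 0)"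

definition core_dist :: "(nat \<Rightarrow> nat set) \<Rightarrow> (nat \<Rightarrow> 'b :: metric_space) \<Rightarrow> (nat \<Rightarrow> 'b) \<Rightarrow> real" where
  "core_dist I a b = (SUP z. core_term I a b z)"

lemma core_term_nonneg: "0 \<le> core_term I a b z"
  unfolding core_term_def by (auto split: prod.split)

lemma bdd_above_core_term: "bdd_above (range (core_term I a b))"
proof (rule bdd_aboveI2)
  fix z :: "nat \<times> nat"
  obtain p i where z: "z = (p, i)" by fastforce
  have "inverse (real (Suc p)) \<le> 1" by (simp add: inverse_le_1_iff)
  then show "core_term I a b z \<le> 1" unfolding z core_term_def by auto
qed

lemma core_term_le_core_dist: "core_term I a b z \<le> core_dist I a b"
  unfolding core_dist_def by (rule cSUP_upper[OF UNIV_I bdd_above_core_term])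

lemma core_dist_upper:
  assumes "i \<in> I p"
  shows "min (inverse (real (Suc p))) (dist (a i) (b i)) \<le> core_dist I a b"
  using core_term_le_core_dist[of I a b "(p, i)"] assms unfolding core_term_def by simp

lemma core_dist_least:
  assumes "0 \<le> e" "\<And>p i. i \<in> I p \<Longrightarrow> min (inverse (real (Suc p))) (dist (a i) (b i)) \<le> e"
  shows "core_dist I a b \<le> e"
  unfolding core_dist_def by (rule cSUP_least) (use assms in \<open>auto simp: core_term_def\<close>)

lemma core_dist_nonneg: "0 \<le> core_dist I a b"
  using core_term_nonneg core_term_le_core_dist by (rule order_trans)

lemma core_dist_commute: "core_dist I a b = core_dist I b a"
  unfolding core_dist_def core_term_def by (simp only: dist_commute)

text \<open>Truncation at a positive constant is subadditive on nonnegative numbers, so each term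
  already satisfies the inequality.\<close>

lemma core_dist_triangle: "core_dist I a b \<le> core_dist I a x + core_dist I x b"
proof (rule core_dist_least)
  show "0 \<le> core_dist I a x + core_dist I x b" using core_dist_nonneg add_nonneg_nonneg by blast
  fix p i assume i: "i \<in> I p"
  have "0 < inverse (real (Suc p))" by simp
  moreover have "dist (a i) (b i) \<le> dist (a i) (x i) + dist (x i) (b i)" by (rule dist_triangle)
  ultimately have "min (inverse (real (Suc p))) (dist (a i) (b i)) \<le>
    min (inverse (real (Suc p))) (dist (a i) (x i)) + min (inverse (real (Suc p))) (dist (x i) (b i))"
    using zero_le_dist[of "a i" "x i"] zero_le_dist[of "x i" "b i"] by linarith
  then show "min (inverse (real (Suc p))) (dist (a i) (b i)) \<le> core_dist I a x + core_dist I x b"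
    using core_dist_upper[of i I p a x, OF i] core_dist_upper[of i I p x b, OF i] by linarith
qed

lemma core_dist_imp_dist:
  assumes "core_dist I a b < inverse (real (Suc p))" "i \<in> I p"
  shows "dist (a i) (b i) \<le> core_dist I a b"
  using core_dist_upper[of i I p a b, OF assms(2)] assms(1) by linarith

text \<open>Levels beyond \<open>p\<close> are controlled by their truncation alone, and levels up
  to \<open>p\<close> use only indices from \<open>I p\<close>.\<close>

lemma core_dist_leI:
  assumes "\<And>p q. p \<le> q \<Longrightarrow> I p \<subseteq> I q" "inverse (real (Suc p)) \<le> e"
    and "\<And>i. i \<in> I p \<Longrightarrow> dist (a i) (b i) \<le> e"
  shows "core_dist I a b \<le> e"
proof (rule core_dist_least)
  have "0 < inverse (real (Suc p))" by simp
  then show "0 \<le> e" using assms(2) by linarith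
  fix q i assume i: "i \<in> I q"
  show "min (inverse (real (Suc q))) (dist (a i) (b i)) \<le> e"
  proof (cases "q \<le> p")
    case True
    then show ?thesis using assms(1)[OF True] assms(3) i by (simp add: min.coboundedI2 subset_iff)
  next
    case False
    then have "inverse (real (Suc q)) \<le> inverse (real (Suc p))" by (simp add: le_imp_inverse_le)
    then show ?thesis using assms(2) by linarith
  qed
qed

text \<open>
  An average of the values \<open>q (ns ! j)\<close> weighted by bumps of radius \<open>\<delta> = 1 / (s + 1)\<close>, where \<open>r j\<close> is the
  distance to the \<open>j\<close>-th point. The lower bound \<open>\<delta> / 2\<close> of the denominator makes it continuous everywhere,
  and has no effect within \<open>\<delta> / 2\<close> of one of the points used.
\<close>

definition bump_average :: "(nat \<Rightarrow> 'b :: real_normed_algebra_1) \<Rightarrow> nat list \<Rightarrow> nat \<Rightarrow> (nat \<Rightarrow> real) \<Rightarrow> 'b" where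
  "bump_average q ns s r =
    (\<Sum>j<length ns. max 0 (inverse (real (Suc s)) - r j) *\<^sub>R q (ns ! j)) /\<^sub>R
      max (inverse (real (Suc s)) / 2) (\<Sum>j<length ns. max 0 (inverse (real (Suc s)) - r j))"

lemma bump_average_denominator_pos:
  "max (inverse (real (Suc s)) / 2) (\<Sum>j<m. max 0 (inverse (real (Suc s)) - r j)) > 0"
  by (simp add: less_max_iff_disj)

text \<open>Continuity in the whole distance sequence serves twice: it gives continuity in the point
  of a fibre, and measurability in the base point.\<close>

lemma continuous_on_bump_average: "continuous_on UNIV (bump_average q ns s)"
  unfolding bump_average_def
  by (intro continuous_intros continuous_on_product_coordinates)
    (rule ballI, rule bump_average_denominator_pos[THEN less_imp_neq, symmetric])

section \<open>A complete metric for the compact-open topology\<close>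

context locally_compact_Polish_metric
begin

abbreviation Cfun :: "('v \<Rightarrow> complex) set" where
  "Cfun \<equiv> continuous_functions mtopology euclidean"

definition Cdist :: "('v \<Rightarrow> complex) \<Rightarrow> ('v \<Rightarrow> complex) \<Rightarrow> real" where
  "Cdist F G = core_dist (core_indices D) (\<lambda>i. F (c i)) (\<lambda>i. G (c i))"

text \<open>The points where two continuous functions differ by at most \<open>e\<close> form a
  closed set, so a bound on the sample points extends to their closure.\<close>

lemma dist_le_on_core:
  assumes F: "F \<in> Cfun" and G: "G \<in> Cfun"
    and le: "\<And>i. i \<in> core_indices D p \<Longrightarrow> dist (F (c i)) (G (c i)) \<le> e" and v: "v \<in> core p"
  shows "dist (F v) (G v) \<le> e"
proof -
  have contF: "continuous_map mtopology euclidean F" and contG: "continuous_map mtopology euclidean G"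
    using F G unfolding continuous_functions_def by auto
  have "continuous_map mtopology euclidean (\<lambda>v. dist (F v) (G v))"
    unfolding continuous_map_metric_iff
  proof (intro ballI allI impI)
    fix v e assume v: "v \<in> W" and e: "(e :: real) > 0"
    obtain r1 where r1: "r1 > 0" "\<And>w. w \<in> W \<Longrightarrow> d v w < r1 \<Longrightarrow> dist (F v) (F w) < e / 2"
      using contF[unfolded continuous_map_metric_iff, rule_format, OF v, of "e / 2"] e by auto
    obtain r2 where r2: "r2 > 0" "\<And>w. w \<in> W \<Longrightarrow> d v w < r2 \<Longrightarrow> dist (G v) (G w) < e / 2"
      using contG[unfolded continuous_map_metric_iff, rule_format, OF v, of "e / 2"] e by auto
    have "dist (dist (F v) (G v)) (dist (F w) (G w)) < e" if "w \<in> W" "d v w < min r1 r2" for w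
    proof -
      have "dist (F v) (F w) < e / 2" "dist (G v) (G w) < e / 2" using r1 r2 that by auto
      then show ?thesis
        unfolding dist_real_def
        using dist_triangle[of "F v" "G v" "F w"] dist_triangle[of "F w" "G v" "G w"]
          dist_triangle[of "F w" "G w" "F v"] dist_triangle[of "F v" "G w" "G v"]
          dist_commute[of "F v" "F w"] dist_commute[of "G v" "G w"] by linarith
    qed
    then show "\<exists>r>0. \<forall>w\<in>W. d v w < r \<longrightarrow> dist (dist (F v) (G v)) (dist (F w) (G w)) < e"
      using r1 r2 by (intro exI[of _ "min r1 r2"]) auto
  qed
  then have "closedin mtopology {v \<in> topspace mtopology. dist (F v) (G v) \<in> {..e}}"
    by (rule closedin_continuous_map_preimage) simp
  moreover have "c ` core_indices D p \<subseteq> {v \<in> topspace mtopology. dist (F v) (G v) \<in> {..e}}"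
    using le c_in by auto
  ultimately have "core p \<subseteq> {v \<in> topspace mtopology. dist (F v) (G v) \<in> {..e}}"
    unfolding core_def by (intro closure_of_minimal)
  then show ?thesis using v by auto
qed

lemma dist_le_Cdist:
  assumes "F \<in> Cfun" "G \<in> Cfun" "Cdist F G < inverse (real (Suc p))" "v \<in> core p"
  shows "dist (F v) (G v) \<le> Cdist F G"
  using dist_le_on_core[OF assms(1,2) _ assms(4)] core_dist_imp_dist[OF assms(3)[unfolded Cdist_def]]
  unfolding Cdist_def by simp

lemma Cdist_leI:
  assumes "inverse (real (Suc p)) \<le> e" "\<And>v. v \<in> core p \<Longrightarrow> dist (F v) (G v) \<le> e"
  shows "Cdist F G \<le> e"
  unfolding Cdist_def
  by (rule core_dist_leI[OF core_indices_mono assms(1)]) (use assms(2) c_in_core in auto)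

lemma in_some_core:
  assumes "v \<in> W"
  obtains p where "v \<in> core p"
proof (rule core_nbhd[OF assms])
  fix p r assume "(r :: real) > 0" "mball v r \<subseteq> core p"
  moreover from this have "v \<in> mball v r" using assms by simp
  ultimately show thesis using that by blast
qed

lemma Cfun_eqI:
  assumes F: "F \<in> Cfun" and G: "G \<in> Cfun" and eq: "\<And>i. F (c i) = G (c i)"
  shows "F = G"
proof (rule extensionalityI)
  show "F \<in> extensional W" "G \<in> extensional W" using F G unfolding continuous_functions_def by auto
  fix v assume "v \<in> W"
  then obtain p where p: "v \<in> core p" by (rule in_some_core)
  have "dist (F v) (G v) \<le> 0" by (rule dist_le_on_core[OF F G _ p]) (simp add: eq)
  then show "F v = G v" by simp
qed

lemma Metric_space_Cdist: "Metric_space Cfun Cdist"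
proof
  show "0 \<le> Cdist F G" "Cdist F G = Cdist G F" for F G
    unfolding Cdist_def by (rule core_dist_nonneg, rule core_dist_commute)
  show "Cdist F H \<le> Cdist F G + Cdist G H" for F G H
    unfolding Cdist_def by (rule core_dist_triangle)
  show "Cdist F G = 0 \<longleftrightarrow> F = G" if FG: "F \<in> Cfun" "G \<in> Cfun" for F G
  proof
    assume 0: "Cdist F G = 0"
    show "F = G"
    proof (rule Cfun_eqI[OF FG])
      fix i
      obtain p where "c i \<in> core p" by (rule in_some_core[OF c_in])
      then have "dist (F (c i)) (G (c i)) \<le> 0" using dist_le_Cdist[OF FG, of p] 0 by simp
      then show "F (c i) = G (c i)" by simp
    qed
  next
    assume "F = G"
    then have "Cdist F G \<le> 0" unfolding Cdist_def by (intro core_dist_least) auto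
    moreover have "0 \<le> Cdist F G" unfolding Cdist_def by (rule core_dist_nonneg)
    ultimately show "Cdist F G = 0" by simp
  qed
qed

sublocale funs: Metric_space Cfun Cdist by (rule Metric_space_Cdist)

abbreviation compact_open :: "('v \<Rightarrow> complex) topology" where
  "compact_open \<equiv> compact_open_topology mtopology euclidean"

lemma openin_Cdist_subbasic:
  assumes K: "compactin mtopology K" and U: "open U"
  shows "openin funs.mtopology {F \<in> Cfun. F ` K \<subseteq> U}"
  unfolding funs.openin_mtopology
proof (intro conjI allI impI)
  fix F assume F: "F \<in> {F \<in> Cfun. F ` K \<subseteq> U}"
  then have FC: "F \<in> Cfun" and cont: "continuous_map mtopology euclidean F"
    unfolding continuous_functions_def by auto
  have "compact (F ` K)" using image_compactin[OF K cont] by simp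
  moreover have "F ` K \<subseteq> U" using F by blast
  ultimately obtain e where e: "e > 0" "(\<Union>x\<in>F ` K. ball x e) \<subseteq> U"
    using compact_subset_open_imp_ball_epsilon_subset[OF _ U] by blast
  obtain p where p: "K \<subseteq> core p" using compactin_subset_core[OF K] by blast
  \<comment> \<open>The bound \<open>1 / (p + 1)\<close> keeps \<open>Cdist\<close> below the
    truncation at level \<open>p\<close>, so that it controls the functions on
    \<open>core p\<close>.\<close>
  define r where "r = min e (inverse (real (Suc p)))"
  have "funs.mball F r \<subseteq> {F \<in> Cfun. F ` K \<subseteq> U}"
  proof
    fix G assume G: "G \<in> funs.mball F r"
    have "G v \<in> U" if v: "v \<in> K" for v
    proof -
      have "dist (F v) (G v) \<le> Cdist F G"
        by (rule dist_le_Cdist[of F G p]) (use FC G r_def p v in auto)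
      then have "G v \<in> ball (F v) e" using G r_def by auto
      then show ?thesis using e(2) v by blast
    qed
    then show "G \<in> {F \<in> Cfun. F ` K \<subseteq> U}" using G by auto
  qed
  moreover have "r > 0" using e r_def by simp
  ultimately show "\<exists>r>0. funs.mball F r \<subseteq> {F \<in> Cfun. F ` K \<subseteq> U}" by blast
qed auto

lemma openin_compact_open_subbasic:
  assumes "compactin mtopology K" "open U"
  shows "openin compact_open {F \<in> Cfun. F ` K \<subseteq> U}"
  unfolding compact_open_topology_def
  by (rule topology_generated_by_Basis, rule CollectI, rule exI[of _ K], rule exI[of _ U])
    (use assms in simp)

text \<open>The core is covered by finitely many compact pieces \<open>K v\<close> on which
  \<open>F\<close> stays within \<open>e\<close> of \<open>F v\<close>. If \<open>G\<close> stays
  within \<open>2 * e\<close> of \<open>F v\<close> on each piece, then \<open>F\<close> and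
  \<open>G\<close> differ by at most \<open>3 * e = r / 2\<close> on the core.\<close>

lemma compact_open_nbhd_in_ball:
  assumes F: "F \<in> Cfun" and r: "r > 0"
  obtains N where "openin compact_open N" "F \<in> N" "N \<subseteq> funs.mball F r"
proof -
  obtain p where p: "inverse (real (Suc p)) < r / 2" using reals_Archimedean r by (metis half_gt_zero)
  define e where "e = r / 6"
  have e: "e > 0" using r e_def by simp
  have cont: "continuous_map mtopology euclidean F" using F unfolding continuous_functions_def by auto
  have compact: "compact (F ` core p)" using image_compactin[OF compactin_core cont] by simp
  obtain A where A: "A \<subseteq> core p" "finite A" "F ` core p \<subseteq> (\<Union>v\<in>A. ball (F v) e)"
    by (rule compactE_image[OF compact, of "core p" "\<lambda>v. ball (F v) e"]) (use e in auto)
  define K where "K = (\<lambda>v. core p \<inter> {w \<in> topspace mtopology. F w \<in> cball (F v) e})"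
  have K: "compactin mtopology (K v)" for v
    unfolding K_def
    by (intro compact_Int_closedin compactin_core closedin_continuous_map_preimage[OF cont]) simp
  \<comment> \<open>The factor \<open>Cfun\<close> gives the right set when \<open>A\<close> is
    empty, where the intersection over \<open>A\<close> is the whole type.\<close>
  define N where "N = Cfun \<inter> (\<Inter>v\<in>A. {G \<in> Cfun. G ` K v \<subseteq> ball (F v) (2 * e)})"
  show ?thesis
  proof (rule that[of N])
    have "openin compact_open (\<Inter>v\<in>A. {G \<in> Cfun. G ` K v \<subseteq> ball (F v) (2 * e)})" if "A \<noteq> {}"
      using that A(2) K by (intro openin_INT2 openin_compact_open_subbasic) auto
    moreover have "openin compact_open Cfun"
      using openin_topspace[of compact_open] by (simp only: topspace_compact_open_topology)
    ultimately show "openin compact_open N" unfolding N_def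
      by (cases "A = {}") (auto intro: openin_Int)
    show "F \<in> N" unfolding N_def K_def using F e by auto
    show "N \<subseteq> funs.mball F r"
    proof
      fix G assume G: "G \<in> N"
      have "dist (F w) (G w) \<le> r / 2" if w: "w \<in> core p" for w
      proof -
        obtain v where v: "v \<in> A" "F w \<in> ball (F v) e" using A(3) w by blast
        then have "w \<in> K v" unfolding K_def using w core_subset by auto
        then have "G w \<in> ball (F v) (2 * e)" using G v unfolding N_def by blast
        then show ?thesis using v(2) dist_triangle3[of "F w" "G w" "F v"] unfolding e_def by auto
      qed
      then have "Cdist F G \<le> r / 2" using p by (intro Cdist_leI[of p]) auto
      then show "G \<in> funs.mball F r" using G F r unfolding N_def by auto
    qed
  qed
qed

lemma Cdist_mtopology: "funs.mtopology = compact_open"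
proof (rule topology_eq[THEN iffD2], intro allI iffI)
  fix U assume U: "openin funs.mtopology U"
  show "openin compact_open U"
  proof (subst openin_subopen, intro ballI)
    fix F assume "F \<in> U"
    then obtain r where r: "r > 0" "funs.mball F r \<subseteq> U" and F: "F \<in> Cfun"
      using U unfolding funs.openin_mtopology by blast
    obtain N where "openin compact_open N" "F \<in> N" "N \<subseteq> funs.mball F r"
      by (rule compact_open_nbhd_in_ball[OF F r(1)])
    then show "\<exists>T. openin compact_open T \<and> F \<in> T \<and> T \<subseteq> U"
      using r(2) by (intro exI[of _ N] conjI) (assumption, assumption, rule order_trans)
  qed
next
  fix U assume "openin compact_open U"
  then have "generate_topology_on {{F \<in> Cfun. F ` K \<subseteq> U} | K U. compactin mtopology K \<and> openin euclidean U} U"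
    unfolding compact_open_topology_def by (simp add: openin_topology_generated_by_iff)
  moreover have "openin funs.mtopology S"
    if "S \<in> {{F \<in> Cfun. F ` K \<subseteq> U} | K U. compactin mtopology K \<and> openin euclidean U}" for S
    using that openin_Cdist_subbasic by auto
  ultimately show "openin funs.mtopology U"
    using generate_topology_on_coarsest[OF istopology_openin] by blast
qed

text \<open>A Cauchy sequence converges uniformly on every core. Continuity of the limit is a local
  matter, and \<open>core_nbhd\<close> puts a neighbourhood of each point inside one core.\<close>

lemma Cdist_mcomplete: "funs.mcomplete"
  unfolding funs.mcomplete_def
proof (intro allI impI)
  fix \<sigma> assume C: "funs.MCauchy \<sigma>"
  then have \<sigma>: "\<sigma> n \<in> Cfun" for n unfolding funs.MCauchy_def by (simp add: image_subset_iff)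
  have unif: "\<exists>N. \<forall>n\<ge>N. \<forall>m\<ge>N. \<forall>v\<in>core p. dist (\<sigma> n v) (\<sigma> m v) < e" if e: "e > 0" for p e
  proof -
    define r where "r = min e (inverse (real (Suc p)))"
    have "r > 0" using e r_def by simp
    then obtain N where N: "\<And>n m. N \<le> n \<Longrightarrow> N \<le> m \<Longrightarrow> Cdist (\<sigma> n) (\<sigma> m) < r"
      using C[unfolded funs.MCauchy_def, THEN conjunct2, rule_format, of r] by auto
    have "dist (\<sigma> n v) (\<sigma> m v) < e" if "N \<le> n" "N \<le> m" "v \<in> core p" for n m v
    proof -
      have "Cdist (\<sigma> n) (\<sigma> m) < e" "Cdist (\<sigma> n) (\<sigma> m) < inverse (real (Suc p))"
        using N[OF that(1,2)] unfolding r_def by simp_all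
      then show ?thesis using dist_le_Cdist[OF \<sigma> \<sigma> _ that(3), of n m] by simp
    qed
    then show ?thesis by (intro exI[of _ N]) blast
  qed
  have "\<exists>l. (\<lambda>n. \<sigma> n v) \<longlonglongrightarrow> l" if v: "v \<in> W" for v
  proof -
    obtain p where p: "v \<in> core p" by (rule in_some_core[OF v])
    have "Cauchy (\<lambda>n. \<sigma> n v)"
    proof (rule metric_CauchyI)
      fix e :: real assume "e > 0"
      then show "\<exists>M. \<forall>m\<ge>M. \<forall>n\<ge>M. dist (\<sigma> m v) (\<sigma> n v) < e"
        using unif[of e p] p by auto
    qed
    then show ?thesis using Cauchy_convergent convergent_def by blast
  qed
  then obtain L where L: "\<And>v. v \<in> W \<Longrightarrow> (\<lambda>n. \<sigma> n v) \<longlonglongrightarrow> L v" by metis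
  define F where "F = restrict L W"
  have unif_F: "\<exists>N. \<forall>n\<ge>N. \<forall>v\<in>core p. dist (\<sigma> n v) (F v) \<le> e" if e: "e > 0" for p e
  proof -
    obtain N where N: "\<And>n m v. N \<le> n \<Longrightarrow> N \<le> m \<Longrightarrow> v \<in> core p \<Longrightarrow> dist (\<sigma> n v) (\<sigma> m v) < e"
      using unif[OF e, of p] by auto
    have "dist (\<sigma> n v) (F v) \<le> e" if n: "N \<le> n" and v: "v \<in> core p" for n v
    proof (rule tendsto_upperbound)
      have "v \<in> W" using v core_subset by blast
      then show "(\<lambda>m. dist (\<sigma> n v) (\<sigma> m v)) \<longlonglongrightarrow> dist (\<sigma> n v) (F v)"
        unfolding F_def by (intro tendsto_dist tendsto_const) (simp add: L)
      show "\<forall>\<^sub>F m in sequentially. dist (\<sigma> n v) (\<sigma> m v) \<le> e"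
        unfolding eventually_sequentially using N[OF n _ v] by (intro exI[of _ N]) (simp add: less_imp_le)
    qed simp
    then show ?thesis by blast
  qed
  have "continuous_map mtopology euclidean F"
    unfolding continuous_map_metric_iff
  proof (intro ballI allI impI)
    fix v e assume v: "v \<in> W" and e: "(e :: real) > 0"
    obtain p r where r: "r > 0" "mball v r \<subseteq> core p" by (rule core_nbhd[OF v])
    obtain n where n: "\<And>w. w \<in> core p \<Longrightarrow> dist (\<sigma> n w) (F w) \<le> e / 4"
      using unif_F[of "e / 4" p] e by auto
    have "continuous_map mtopology euclidean (\<sigma> n)" using \<sigma> unfolding continuous_functions_def by auto
    from this[unfolded continuous_map_metric_iff, rule_format, OF v, of "e / 4"]
    obtain t where t: "t > 0" "\<And>w. w \<in> W \<Longrightarrow> d v w < t \<Longrightarrow> dist (\<sigma> n v) (\<sigma> n w) < e / 4"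
      using e by auto
    have "dist (F v) (F w) < e" if w: "w \<in> W" "d v w < min r t" for w
    proof -
      have "v \<in> core p" "w \<in> core p" using r v w by auto
      then have "dist (\<sigma> n v) (F v) \<le> e / 4" "dist (\<sigma> n w) (F w) \<le> e / 4" using n by auto
      moreover have "dist (\<sigma> n v) (\<sigma> n w) < e / 4" using t w by auto
      ultimately show ?thesis
        using dist_triangle3[of "F v" "F w" "\<sigma> n v"] dist_triangle[of "\<sigma> n v" "F w" "\<sigma> n w"] e by linarith
    qed
    then show "\<exists>r>0. \<forall>w\<in>W. d v w < r \<longrightarrow> dist (F v) (F w) < e"
      using r(1) t(1) by (intro exI[of _ "min r t"]) auto
  qed
  then have F: "F \<in> Cfun" unfolding continuous_functions_def F_def by auto
  have "limitin funs.mtopology \<sigma> F sequentially"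
    unfolding funs.limit_metric_sequentially
  proof (intro conjI allI impI F)
    fix e :: real assume e: "e > 0"
    obtain p where p: "inverse (real (Suc p)) < e / 2" using reals_Archimedean e by (metis half_gt_zero)
    obtain N where N: "\<And>n v. n \<ge> N \<Longrightarrow> v \<in> core p \<Longrightarrow> dist (\<sigma> n v) (F v) \<le> e / 2"
      using unif_F[of "e / 2" p] e by auto
    have "Cdist (\<sigma> n) F < e" if "n \<ge> N" for n
    proof -
      have "Cdist (\<sigma> n) F \<le> e / 2" using p N[OF that] by (intro Cdist_leI[of p]) auto
      then show ?thesis using e by simp
    qed
    then show "\<exists>N. \<forall>n\<ge>N. \<sigma> n \<in> Cfun \<and> Cdist (\<sigma> n) F < e" using \<sigma> by blast
  qed
  then show "\<exists>F. limitin funs.mtopology \<sigma> F sequentially" by blast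
qed

section \<open>A countable dense family of continuous functions\<close>

definition approximant :: "(nat \<Rightarrow> complex) \<Rightarrow> nat list \<Rightarrow> nat \<Rightarrow> 'v \<Rightarrow> complex" where
  "approximant q ns s = (\<lambda>v\<in>W. bump_average q ns s (\<lambda>j. d (c j) v))"

lemma approximant_in_Cfun: "approximant q ns s \<in> Cfun"
proof -
  have "continuous_map mtopology euclidean (\<lambda>v. d (c j) v)" for j
    unfolding continuous_map_metric_iff
  proof (intro ballI allI impI)
    fix v e assume v: "v \<in> W" and e: "(e :: real) > 0"
    have "dist (d (c j) v) (d (c j) w) < e" if "w \<in> W" "d v w < e" for w
      using mdist_reverse_triangle[OF v c_in that(1), of j] that(2)
      by (simp only: dist_real_def commute[of v "c j"])
    then show "\<exists>r>0. \<forall>w\<in>W. d v w < r \<longrightarrow> dist (d (c j) v) (d (c j) w) < e" using e by blast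
  qed
  then have "continuous_map mtopology (product_topology (\<lambda>_. euclidean) UNIV) (\<lambda>v j. d (c j) v)"
    by (subst continuous_map_componentwise_UNIV) blast
  then have "continuous_map mtopology euclidean (\<lambda>v j. d (c j) v)"
    by (simp only: euclidean_product_topology)
  moreover have "continuous_map euclidean euclidean (bump_average q ns s)"
    using continuous_on_bump_average by (simp add: continuous_map_iff_continuous2)
  ultimately have "continuous_map mtopology euclidean (bump_average q ns s \<circ> (\<lambda>v j. d (c j) v))"
    by (rule continuous_map_compose)
  then have "continuous_map mtopology euclidean (approximant q ns s)"
    by (rule continuous_map_eq) (simp add: approximant_def)
  then show ?thesis unfolding continuous_functions_def approximant_def by auto
qed

text \<open>At a point \<open>v\<close> of the core only sample points within
  \<open>\<delta>\<close> of \<open>v\<close> have weight. There \<open>q (n j)\<close> is within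
  \<open>r / 4\<close> of \<open>F (c j)\<close>, which is within \<open>r / 4\<close> of
  \<open>F v\<close>; an average of such values is within \<open>r / 2\<close>.\<close>

lemma approximant_dense:
  assumes q: "\<And>z e. e > 0 \<Longrightarrow> \<exists>n. dist z (q n) < e" and F: "F \<in> Cfun" and r: "r > 0"
  shows "\<exists>ns s. Cdist F (approximant q ns s) < r"
proof -
  obtain p where p: "inverse (real (Suc p)) < r / 2" using reals_Archimedean r by (metis half_gt_zero)
  have cont: "continuous_map mtopology euclidean F" using F unfolding continuous_functions_def by auto
  obtain t where t: "t > 0" "\<And>x w. x \<in> core p \<Longrightarrow> w \<in> W \<Longrightarrow> d x w < t \<Longrightarrow> dist (F x) (F w) < r / 4"
    by (rule continuous_map_uniform_near_compact[OF compactin_core cont, of "r / 4" p]) (use r in auto)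
  obtain s where s: "inverse (real (Suc s)) < t" using reals_Archimedean t by blast
  define \<delta> where "\<delta> = inverse (real (Suc s))"
  have \<delta>: "\<delta> > 0" unfolding \<delta>_def by simp
  \<comment> \<open>Two quarters of \<open>\<delta>\<close>, one for the net and one for moving its
    points into the dense sequence, put a sample point within \<open>\<delta> / 2\<close> of each
    core point. The total weight is then at least \<open>\<delta> / 2\<close>, and the maximum in
    the denominator has no effect.\<close>
  obtain A where A: "finite A" "A \<subseteq> core p" "core p \<subseteq> (\<Union>x\<in>A. mball x (\<delta> / 4))"
    by (rule compactin_finite_subcover[OF compactin_core, of p "\<lambda>_. \<delta> / 4"]) (use \<delta> in auto)
  have "\<exists>l. d x (c l) < \<delta> / 4" if "x \<in> A" for x
    using approx[of x "\<delta> / 4"] that A(2) core_subset \<delta> by (metis divide_pos_pos subsetD zero_less_numeral)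
  then obtain l where l: "\<And>x. x \<in> A \<Longrightarrow> d x (c (l x)) < \<delta> / 4" by metis
  obtain m where m: "\<And>x. x \<in> A \<Longrightarrow> l x < m"
    using finite_nat_set_iff_bounded[of "l ` A"] A(1) by auto
  have "\<exists>n. dist (F (c j)) (q n) < r / 4" for j
    by (rule q) (use r in simp)
  then obtain n where n: "\<And>j. dist (F (c j)) (q (n j)) < r / 4" by metis
  \<comment> \<open>All indices below \<open>m\<close> receive a bump, not only those of the net;
    the extra ones either vanish at \<open>v\<close> or lie close enough to be harmless.\<close>
  define ns where "ns = map n [0..<m]"
  have ns: "length ns = m" "\<And>j. j < m \<Longrightarrow> ns ! j = n j" unfolding ns_def by auto
  have "dist (F v) (approximant q ns s v) \<le> r / 2" if v: "v \<in> core p" for v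
  proof -
    have vW: "v \<in> W" using v core_subset by blast
    define \<psi> where "\<psi> = (\<lambda>j. max 0 (\<delta> - d (c j) v))"
    define S where "S = (\<Sum>j<m. \<psi> j)"
    have \<psi>0: "\<psi> j \<ge> 0" for j unfolding \<psi>_def by simp
    obtain x where x: "x \<in> A" "d x v < \<delta> / 4" and xW: "x \<in> W" using A v by auto
    have "d (c (l x)) v \<le> \<delta> / 2" using triangle''[OF c_in xW vW, of "l x"] x l[OF x(1)] by linarith
    then have "\<delta> / 2 \<le> \<psi> (l x)" unfolding \<psi>_def by (intro max.coboundedI2) linarith
    also have "\<dots> \<le> S" unfolding S_def
      by (rule member_le_sum) (use m[OF x(1)] \<psi>0 in auto)
    finally have S: "\<delta> / 2 \<le> S" .
    then have S0: "S > 0" using \<delta> by linarith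
    have "approximant q ns s v = (\<Sum>j<m. \<psi> j *\<^sub>R q (n j)) /\<^sub>R S"
      unfolding approximant_def bump_average_def
      using vW S ns by (simp add: \<psi>_def \<delta>_def S_def max_absorb2)
    moreover have "F v = (\<Sum>j<m. \<psi> j *\<^sub>R F v) /\<^sub>R S"
      using S0 unfolding S_def by (simp flip: scaleR_left.sum)
    ultimately have "F v - approximant q ns s v = (\<Sum>j<m. \<psi> j *\<^sub>R (F v - q (n j))) /\<^sub>R S"
      by (simp add: scaleR_diff_right sum_subtractf)
    then have eq: "dist (F v) (approximant q ns s v) = norm (\<Sum>j<m. \<psi> j *\<^sub>R (F v - q (n j))) / S"
      using S0 by (simp add: dist_norm divide_inverse mult.commute)
    have "norm (\<Sum>j<m. \<psi> j *\<^sub>R (F v - q (n j))) \<le> (\<Sum>j<m. \<psi> j * (r / 2))"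
    proof (rule sum_norm_le)
      fix j
      show "norm (\<psi> j *\<^sub>R (F v - q (n j))) \<le> \<psi> j * (r / 2)"
      proof (cases "d (c j) v < \<delta>")
        case True
        then have "d v (c j) < t" using s commute[of v "c j"] unfolding \<delta>_def by linarith
        then have "dist (F v) (F (c j)) < r / 4" by (rule t(2)[OF v c_in])
        then have "dist (F v) (q (n j)) \<le> r / 2"
          using n[of j] dist_triangle[of "F v" "q (n j)" "F (c j)"] by linarith
        from mult_left_mono[OF this \<psi>0[of j]] show ?thesis
          using \<psi>0[of j] by (simp add: dist_norm)
      next
        case False
        then have "\<psi> j = 0" unfolding \<psi>_def by simp
        then show ?thesis by simp
      qed
    qed
    also have "(\<Sum>j<m. \<psi> j * (r / 2)) = S * (r / 2)" unfolding S_def by (simp add: sum_distrib_right)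
    finally show ?thesis unfolding eq using S0 by (simp add: pos_divide_le_eq mult.commute)
  qed
  then have "Cdist F (approximant q ns s) \<le> r / 2" using p by (intro Cdist_leI[of p]) auto
  then show ?thesis using r by (intro exI[of _ ns] exI[of _ s]) simp
qed

lemma approximant_closure_of:
  assumes q: "\<And>z e. e > 0 \<Longrightarrow> \<exists>n. dist z (q n) < e"
  shows "compact_open closure_of (range (\<lambda>(ns, s). approximant q ns s)) = Cfun"
proof -
  have "funs.mtopology closure_of (range (\<lambda>(ns, s). approximant q ns s)) = Cfun"
    unfolding funs.metric_closure_of
  proof (intro equalityI subsetI CollectI conjI allI impI)
    fix F and r :: real assume F: "F \<in> Cfun" and r: "r > 0"
    obtain ns s where "Cdist F (approximant q ns s) < r" using approximant_dense[OF q F r] by blast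
    then show "\<exists>y\<in>range (\<lambda>(ns, s). approximant q ns s). y \<in> funs.mball F r"
      using F approximant_in_Cfun by (intro bexI[of _ "approximant q ns s"]) auto
  qed auto
  then show ?thesis by (simp only: Cdist_mtopology)
qed

lemma Polish_space_compact_open: "Polish_space compact_open"
proof -
  obtain D :: "complex set" where D: "countable D" "\<And>X. open X \<Longrightarrow> X \<noteq> {} \<Longrightarrow> \<exists>d\<in>D. d \<in> X"
    using countable_dense_setE by blast
  have q: "\<exists>n. dist z (from_nat_into D n) < e" if e: "e > 0" for z e
  proof -
    obtain x where x: "x \<in> D" "x \<in> ball z e" using D(2)[of "ball z e"] e by auto
    then show ?thesis using from_nat_into_surj[OF D(1)] by (metis mem_ball)
  qed
  have "separable_space compact_open"
    unfolding separable_space_def topspace_compact_open_topology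
    by (rule exI[of _ "range (\<lambda>(ns, s). approximant (from_nat_into D) ns s)"])
      (use approximant_closure_of[OF q] approximant_in_Cfun in auto)
  moreover have "completely_metrizable_space compact_open"
    unfolding completely_metrizable_space_def
    using funs.Metric_space_axioms Cdist_mcomplete Cdist_mtopology by metis
  ultimately show ?thesis unfolding Polish_space_def by blast
qed

end

section \<open>The Borel structure on continuous functions\<close>

lemma space_fibre_product:
  "space (fibre_product M N) = {(v, w). v \<in> space M \<and> w \<in> space N \<and> fst v = fst w}"
  unfolding fibre_product_def by (auto simp: space_restrict_space space_pair_measure)

lemma measurable_fibre_product_fst: "fst \<in> measurable (fibre_product M N) M"
  unfolding fibre_product_def by (rule measurable_restrict_space1) simp

lemma measurable_fibre_product_snd: "snd \<in> measurable (fibre_product M N) N"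
  unfolding fibre_product_def by (rule measurable_restrict_space1) simp

lemma measurable_into_fibre_product:
  assumes "f \<in> measurable L M" "g \<in> measurable L N" "\<And>z. z \<in> space L \<Longrightarrow> fst (f z) = fst (g z)"
  shows "(\<lambda>z. (f z, g z)) \<in> measurable L (fibre_product M N)"
  unfolding fibre_product_def
  by (rule measurable_restrict_space2) (use assms in auto)

section \<open>Sampling along the Borel sections\<close>

locale locally_compact_Borel_field =
  fixes X :: "'x measure" and V :: "'x \<Rightarrow> 'v topology" and M :: "('x \<times> 'v) measure"
    and d :: "('x \<times> 'v) \<times> ('x \<times> 'v) \<Rightarrow> real" and \<phi> :: "nat \<Rightarrow> 'x \<Rightarrow> 'v"
  assumes standard_borel_X: "standard_borel X"
    and space_M: "space M = disjoint_union (space X) V"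
    and fst_M: "fst \<in> measurable M X"
    and d_measurable: "d \<in> borel_measurable (fibre_product M M)"
    and metric: "x \<in> space X \<Longrightarrow> Metric_space (topspace (V x)) (\<lambda>u w. d ((x, u), (x, w)))"
    and metric_complete: "x \<in> space X \<Longrightarrow>
      Metric_space.mcomplete (topspace (V x)) (\<lambda>u w. d ((x, u), (x, w)))"
    and metric_topology: "x \<in> space X \<Longrightarrow>
      Metric_space.mtopology (topspace (V x)) (\<lambda>u w. d ((x, u), (x, w))) = V x"
    and section_measurable: "(\<lambda>x. (x, \<phi> n x)) \<in> measurable X M"
    and section_dense: "x \<in> space X \<Longrightarrow> V x closure_of range (\<lambda>n. \<phi> n x) = topspace (V x)"
    and fibre_locally_compact: "x \<in> space X \<Longrightarrow> locally_compact_space (V x)"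
begin

lemma section_in: "x \<in> space X \<Longrightarrow> \<phi> n x \<in> topspace (V x)"
  using measurable_space[OF section_measurable] unfolding space_M disjoint_union_def by auto

lemma fibre:
  assumes "x \<in> space X"
  shows "locally_compact_Polish_metric (topspace (V x)) (\<lambda>u w. d ((x, u), (x, w))) (\<lambda>i. \<phi> i x)"
proof -
  interpret Metric_space "topspace (V x)" "\<lambda>u w. d ((x, u), (x, w))" by (rule metric[OF assms])
  show ?thesis
  proof unfold_locales
    show "\<phi> n x \<in> topspace (V x)" for n by (rule section_in[OF assms])
    show "mtopology closure_of range (\<lambda>i. \<phi> i x) = topspace (V x)"
      unfolding metric_topology[OF assms] by (rule section_dense[OF assms])
    show mcomplete by (rule metric_complete[OF assms])
    show "locally_compact_space mtopology"
      unfolding metric_topology[OF assms] by (rule fibre_locally_compact[OF assms])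
  qed
qed

definition \<D> :: "'x \<Rightarrow> nat \<Rightarrow> nat \<Rightarrow> real" where
  "\<D> x i j = d ((x, \<phi> i x), (x, \<phi> j x))"

lemma measurable_\<D> [measurable]: "(\<lambda>x. \<D> x i j) \<in> borel_measurable X"
  unfolding \<D>_def
  by (rule measurable_compose[OF measurable_into_fibre_product[OF section_measurable section_measurable] d_measurable])
    simp

lemma measurable_section_dist: "(\<lambda>z. d ((fst z, \<phi> i (fst z)), z)) \<in> borel_measurable M"
  by (rule measurable_compose[OF measurable_into_fibre_product d_measurable])
    (auto intro: measurable_compose[OF fst_M section_measurable])

lemma measurable_totally_bounded_ball [measurable]:
  "Measurable.pred X (\<lambda>x. totally_bounded_ball (\<D> x) n k)"
  unfolding totally_bounded_ball_def by measurable

lemma measurable_core_indices [measurable]: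
  "Measurable.pred X (\<lambda>x. i \<in> core_indices (\<D> x) p)"
  unfolding core_indices_def mem_Collect_eq by measurable

definition sample :: "'x \<times> ('v \<Rightarrow> complex) \<Rightarrow> 'x \<times> (nat \<Rightarrow> complex)" where
  "sample = (\<lambda>(x, F). (x, \<lambda>i. F (\<phi> i x)))"

definition carrier :: "('x \<times> ('v \<Rightarrow> complex)) set" where
  "carrier = disjoint_union (space X) (function_field V)"

lemma carrier_eq: "carrier = (SIGMA x:space X. continuous_functions (V x) euclidean)"
  unfolding carrier_def disjoint_union_def topspace_compact_open_topology by simp

definition coded :: "('x \<times> (nat \<Rightarrow> complex)) measure" where
  "coded = X \<Otimes>\<^sub>M borel"

definition function_structure :: "('x \<times> ('v \<Rightarrow> complex)) measure" where
  "function_structure = vimage_algebra carrier sample coded"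

lemma space_coded: "space coded = space X \<times> UNIV"
  unfolding coded_def by (simp add: space_pair_measure)

lemma space_function_structure: "space function_structure = carrier"
  unfolding function_structure_def by (simp add: space_vimage_algebra)

lemma measurable_fst_coded [measurable]: "fst \<in> measurable coded X"
  unfolding coded_def by measurable

lemma measurable_coordinate_coded [measurable]: "(\<lambda>z. snd z i) \<in> borel_measurable coded"
  unfolding coded_def by (rule measurable_compose[OF measurable_snd]) (rule measurable_product_coordinates)

lemma measurable_into_coded:
  assumes "f \<in> measurable L X" "\<And>i. (\<lambda>z. a z i) \<in> borel_measurable L"
  shows "(\<lambda>z. (f z, a z)) \<in> measurable L coded"
  unfolding coded_def using assms by (intro measurable_Pair measurable_coordinatewise_then_product)

lemma inj_on_sample: "inj_on sample carrier"
proof (rule inj_onI)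
  fix z w assume z: "z \<in> carrier" and w: "w \<in> carrier" and eq: "sample z = sample w"
  obtain x F y G where zw: "z = (x, F)" "w = (y, G)" by fastforce
  have xy: "y = x" and FG: "F (\<phi> i x) = G (\<phi> i x)" for i
    using eq unfolding zw sample_def by (auto dest: fun_cong)
  have x: "x \<in> space X" and F: "F \<in> continuous_functions (V x) euclidean"
    and G: "G \<in> continuous_functions (V x) euclidean"
    using z w unfolding zw xy carrier_eq by auto
  have "F = G"
    using locally_compact_Polish_metric.Cfun_eqI[OF fibre[OF x], unfolded metric_topology[OF x], OF F G FG] .
  then show "z = w" unfolding zw xy by simp
qed

text \<open>The two inclusions are the two halves of the extension criterion on a single fibre. The
  extension is restricted to the fibre to obtain the chosen representative of the function.\<close>

lemma sample_carrier: "sample ` carrier = {z \<in> space coded. core_uniform (\<D> (fst z)) (snd z)}"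
proof (intro equalityI subsetI)
  fix z assume "z \<in> sample ` carrier"
  then obtain x F where z: "z = (x, \<lambda>i. F (\<phi> i x))" and x: "x \<in> space X"
    and F: "F \<in> continuous_functions (V x) euclidean"
    unfolding sample_def carrier_eq by auto
  have "continuous_map (V x) euclidean F" using F unfolding continuous_functions_def by simp
  from locally_compact_Polish_metric.core_uniform_continuous[OF fibre[OF x], unfolded metric_topology[OF x], OF this]
  show "z \<in> {z \<in> space coded. core_uniform (\<D> (fst z)) (snd z)}"
    unfolding z space_coded \<D>_def using x by simp
next
  fix z assume "z \<in> {z \<in> space coded. core_uniform (\<D> (fst z)) (snd z)}"
  then obtain x a where z: "z = (x, a)" and x: "x \<in> space X" and a: "core_uniform (\<D> x) a"
    unfolding space_coded by auto
  obtain F where F: "continuous_map (V x) euclidean F" "\<And>i. F (\<phi> i x) = a i"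
    using locally_compact_Polish_metric.continuous_extension[OF fibre[OF x], unfolded metric_topology[OF x], of a]
      a unfolding \<D>_def by blast
  let ?F = "restrict F (topspace (V x))"
  have "continuous_map (V x) euclidean ?F" by (rule continuous_map_eq[OF F(1)]) simp
  then have "(x, ?F) \<in> carrier" unfolding carrier_eq continuous_functions_def using x by simp
  moreover have "sample (x, ?F) = z"
    unfolding z sample_def using F(2) section_in[OF x] by simp
  ultimately show "z \<in> sample ` carrier" by (metis image_eqI)
qed

lemma sample_carrier_sets: "sample ` carrier \<in> sets coded"
  unfolding sample_carrier core_uniform_def by measurable

lemma standard_borel_function_structure: "standard_borel function_structure"
  unfolding function_structure_def
  by (rule standard_borel_vimage_algebra[OF _ inj_on_sample sample_carrier_sets])
    (unfold coded_def, rule standard_borel_pair_borel[OF standard_borel_X])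

lemma sample_in_coded: "z \<in> carrier \<Longrightarrow> sample z \<in> space coded"
  using sample_carrier by blast

lemma measurable_sample: "sample \<in> measurable function_structure coded"
  unfolding function_structure_def by (rule measurable_vimage_algebra1) (use sample_in_coded in blast)

lemma measurable_fst_function_structure: "fst \<in> measurable function_structure X"
proof -
  have "(\<lambda>z. fst (sample z)) \<in> measurable function_structure X"
    by (rule measurable_compose[OF measurable_sample measurable_fst_coded])
  moreover have "fst (sample z) = fst z" for z unfolding sample_def by (simp add: case_prod_unfold)
  ultimately show ?thesis by simp
qed

lemma measurable_coordinate:
  "(\<lambda>z. snd z (\<phi> i (fst z))) \<in> borel_measurable function_structure"
proof -
  have "(\<lambda>z. snd (sample z) i) \<in> borel_measurable function_structure"
    by (rule measurable_compose[OF measurable_sample measurable_coordinate_coded])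
  then show ?thesis unfolding sample_def by (simp add: case_prod_unfold)
qed

text \<open>The universal property of the pullback, with sequence space reduced to its coordinates.
  The dense sections and the algebraic operations are all measured through it.\<close>

lemma measurable_into_function_structure:
  assumes "\<And>z. z \<in> space L \<Longrightarrow> f z \<in> space X \<and> F z \<in> continuous_functions (V (f z)) euclidean"
    and "f \<in> measurable L X" "\<And>i. (\<lambda>z. F z (\<phi> i (f z))) \<in> borel_measurable L"
  shows "(\<lambda>z. (f z, F z)) \<in> measurable L function_structure"
  unfolding function_structure_def
proof (rule measurable_vimage_algebra2)
  show "(\<lambda>z. (f z, F z)) \<in> space L \<rightarrow> carrier" using assms(1) unfolding carrier_eq by auto
  show "(\<lambda>z. sample (f z, F z)) \<in> measurable L coded"
    unfolding sample_def by (simp add: measurable_into_coded assms)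
qed

text \<open>
  \<open>F v\<close> is the limit of the values of \<open>F\<close> at points of the dense sequence that approach \<open>v\<close>, chosen
  in a measurable way.
\<close>

lemma measurable_evaluation:
  "(\<lambda>((x, F), (y, v)). F v) \<in> borel_measurable (fibre_product function_structure M)"
proof -
  let ?L = "fibre_product function_structure M"
  \<comment> \<open>The least index makes the choice measurable: each condition compared is
    measurable in \<open>z\<close>, and density of the sections ensures that an index exists at
    points of \<open>space M\<close>.\<close>
  define s where "s = (\<lambda>k (z :: 'x \<times> 'v). LEAST n. d ((fst z, \<phi> n (fst z)), z) < inverse (real (Suc k)))"
  note measurable_section_dist [measurable]
  have s: "s k \<in> measurable M (count_space UNIV)" for k
    unfolding s_def by measurable
  have s': "(\<lambda>z. s k (snd z)) \<in> measurable ?L (count_space UNIV)" for k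
    by (rule measurable_compose[OF measurable_fibre_product_snd s])
  have coord: "(\<lambda>z. snd (fst z) (\<phi> i (fst (fst z)))) \<in> borel_measurable ?L" for i
    by (rule measurable_compose[OF measurable_fibre_product_fst measurable_coordinate])
  have "(\<lambda>z. snd (fst z) (snd (snd z))) \<in> borel_measurable ?L"
  proof (rule borel_measurable_LIMSEQ_metric)
    show "(\<lambda>z. snd (fst z) (\<phi> (s k (snd z)) (fst (fst z)))) \<in> borel_measurable ?L" for k
      by (rule measurable_compose_countable[OF coord s'])
    fix z assume "z \<in> space ?L"
    then obtain x F v where z: "z = ((x, F), (x, v))" and x: "x \<in> space X"
      and F: "F \<in> continuous_functions (V x) euclidean" and v: "v \<in> topspace (V x)"
      unfolding space_fibre_product space_function_structure space_M carrier_eq disjoint_union_def by auto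
    interpret fib: locally_compact_Polish_metric "topspace (V x)" "\<lambda>u w. d ((x, u), (x, w))" "\<lambda>i. \<phi> i x"
      by (rule fibre[OF x])
    have near: "d ((x, \<phi> (s k (x, v)) x), (x, v)) < inverse (real (Suc k))" for k
    proof -
      obtain n where "d ((x, v), (x, \<phi> n x)) < inverse (real (Suc k))"
        using fib.approx[OF v, of "inverse (real (Suc k))"] by auto
      then have "d ((x, \<phi> n x), (x, v)) < inverse (real (Suc k))" by (simp add: fib.commute[of v])
      then show ?thesis unfolding s_def fst_conv by (rule LeastI)
    qed
    have cont: "continuous_map fib.mtopology euclidean F"
      unfolding metric_topology[OF x] using F unfolding continuous_functions_def by simp
    show "(\<lambda>k. snd (fst z) (\<phi> (s k (snd z)) (fst (fst z)))) \<longlonglongrightarrow> snd (fst z) (snd (snd z))"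
      unfolding z fst_conv snd_conv
    proof (rule metric_LIMSEQ_I)
      fix e :: real assume e: "e > 0"
      obtain r where r: "r > 0" "\<And>w. w \<in> topspace (V x) \<Longrightarrow> d ((x, v), (x, w)) < r \<Longrightarrow> dist (F v) (F w) < e"
        using cont[unfolded fib.continuous_map_metric_iff, rule_format, OF v e] by blast
      obtain N where N: "inverse (real (Suc N)) < r" using reals_Archimedean r(1) by blast
      have "dist (F (\<phi> (s k (x, v)) x)) (F v) < e" if "k \<ge> N" for k
      proof -
        have "inverse (real (Suc k)) \<le> inverse (real (Suc N))" using that by (simp add: le_imp_inverse_le)
        then have "d ((x, v), (x, \<phi> (s k (x, v)) x)) < r"
          using near[of k] N fib.commute[of v "\<phi> (s k (x, v)) x"] by linarith
        from r(2)[OF section_in[OF x] this] show ?thesis by (simp add: dist_commute)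
      qed
      then show "\<exists>N. \<forall>k\<ge>N. dist (F (\<phi> (s k (x, v)) x)) (F v) < e" by blast
    qed
  qed
  then show ?thesis by (simp add: case_prod_unfold)
qed

section \<open>Existence and uniqueness of the Borel structure\<close>

lemma evaluation_Borel_structure_function_structure:
  "evaluation_Borel_structure X V M function_structure"
  unfolding evaluation_Borel_structure_def
  using standard_borel_function_structure measurable_fst_function_structure measurable_evaluation
  by (simp add: space_function_structure carrier_def)

text \<open>A Borel section turns evaluation into a coordinate: \<open>z\<close> is sent measurably
  to the pair of \<open>z\<close> and the section over its base point. So all coordinates, and with
  them \<open>sample\<close>, are measurable for \<open>N\<close>, which gives one inclusion; nested
  standard Borel structures then agree.\<close>

lemma sets_evaluation_Borel_structure:
  assumes "evaluation_Borel_structure X V M N"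
  shows "sets N = sets function_structure"
proof -
  have N: "standard_borel N" "space N = carrier" "fst \<in> measurable N X"
    and ev: "(\<lambda>((x, F), (y, v)). F v) \<in> borel_measurable (fibre_product N M)"
    using assms unfolding evaluation_Borel_structure_def carrier_def by auto
  have "(\<lambda>z. snd z (\<phi> i (fst z))) \<in> borel_measurable N" for i
  proof -
    have "(\<lambda>z. (z, (fst z, \<phi> i (fst z)))) \<in> measurable N (fibre_product N M)"
      by (rule measurable_into_fibre_product)
        (auto intro: measurable_compose[OF N(3) section_measurable])
    from measurable_compose[OF this ev] show ?thesis by (simp add: case_prod_unfold)
  qed
  then have "(\<lambda>z. (fst z, \<lambda>i. snd z (\<phi> i (fst z)))) \<in> measurable N coded"
    by (intro measurable_into_coded N(3))
  then have "sample \<in> measurable N coded" unfolding sample_def by (simp add: case_prod_unfold)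
  then have "sets function_structure \<subseteq> sets N"
    unfolding function_structure_def by (intro sets_image_in_sets N(2))
  then show ?thesis
    using standard_borel_sets_eqI[OF standard_borel_function_structure N(1)] N(2)
    by (simp add: space_function_structure)
qed

section \<open>The function spaces as a Borel field\<close>

lemma function_field_metric:
  assumes "x \<in> space X"
  defines "D \<equiv> (\<lambda>F G. core_dist (core_indices (\<D> x)) (\<lambda>i. F (\<phi> i x)) (\<lambda>i. G (\<phi> i x)))"
  shows "Metric_space (topspace (function_field V x)) D"
    and "Metric_space.mcomplete (topspace (function_field V x)) D"
    and "Metric_space.mtopology (topspace (function_field V x)) D = function_field V x"
proof -
  interpret fib: locally_compact_Polish_metric "topspace (V x)" "\<lambda>u w. d ((x, u), (x, w))" "\<lambda>i. \<phi> i x"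
    by (rule fibre[OF assms(1)])
  have D: "D = fib.Cdist" unfolding D_def fib.Cdist_def \<D>_def by (intro ext) simp
  note top = metric_topology[OF assms(1)]
  show "Metric_space (topspace (function_field V x)) D"
    using fib.Metric_space_Cdist unfolding D top topspace_compact_open_topology .
  show "Metric_space.mcomplete (topspace (function_field V x)) D"
    using fib.Cdist_mcomplete unfolding D top topspace_compact_open_topology .
  show "Metric_space.mtopology (topspace (function_field V x)) D = function_field V x"
    using fib.Cdist_mtopology unfolding D top topspace_compact_open_topology .
qed

lemma measurable_function_metric:
  "(\<lambda>((x, F), (y, G)). core_dist (core_indices (\<D> x)) (\<lambda>i. F (\<phi> i x)) (\<lambda>i. G (\<phi> i x)))
    \<in> borel_measurable (fibre_product function_structure function_structure)"
proof -
  let ?L = "fibre_product function_structure function_structure"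
  have base [measurable]: "(\<lambda>z. fst (fst z)) \<in> measurable ?L X"
    by (rule measurable_compose[OF measurable_fibre_product_fst measurable_fst_function_structure])
  have 1 [measurable]: "(\<lambda>z. snd (fst z) (\<phi> i (fst (fst z)))) \<in> borel_measurable ?L" for i
    by (rule measurable_compose[OF measurable_fibre_product_fst measurable_coordinate])
  have "(\<lambda>z. snd (snd z) (\<phi> i (fst (snd z)))) \<in> borel_measurable ?L" for i
    by (rule measurable_compose[OF measurable_fibre_product_snd measurable_coordinate])
  \<comment> \<open>The two base points agree on the fibre product, so the second function may be
    sampled over the first base point, as the formula for the metric requires.\<close>
  then have 2 [measurable]: "(\<lambda>z. snd (snd z) (\<phi> i (fst (fst z)))) \<in> borel_measurable ?L" for i
    by (rule measurable_cong[THEN iffD1, rotated]) (auto simp: space_fibre_product)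
  have "(\<lambda>z. core_term (core_indices (\<D> (fst (fst z)))) (\<lambda>i. snd (fst z) (\<phi> i (fst (fst z))))
      (\<lambda>i. snd (snd z) (\<phi> i (fst (fst z)))) t) \<in> borel_measurable ?L" for t
  proof -
    obtain p i where t: "t = (p, i)" by fastforce
    show ?thesis unfolding t core_term_def prod.case by measurable
  qed
  then have "(\<lambda>z. core_dist (core_indices (\<D> (fst (fst z)))) (\<lambda>i. snd (fst z) (\<phi> i (fst (fst z))))
      (\<lambda>i. snd (snd z) (\<phi> i (fst (fst z))))) \<in> borel_measurable ?L"
    unfolding core_dist_def by (intro borel_measurable_cSUP bdd_above_core_term) auto
  then show ?thesis by (simp add: case_prod_unfold)
qed

text \<open>A single natural number codes both the list of values and the bump radius, so that the
  countable family becomes a sequence of sections.\<close>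

definition approximating_section :: "(nat \<Rightarrow> complex) \<Rightarrow> nat \<Rightarrow> 'x \<Rightarrow> 'v \<Rightarrow> complex" where
  "approximating_section q n x = (case from_nat n of (ns, s) \<Rightarrow>
    locally_compact_Polish_metric.approximant (topspace (V x)) (\<lambda>u w. d ((x, u), (x, w))) (\<lambda>i. \<phi> i x) q ns s)"

text \<open>At a sample point \<open>\<phi> i x\<close> the approximant is a continuous function of
  the distances \<open>\<D> x j i\<close> alone, and these are measurable in
  \<open>x\<close>.\<close>

lemma measurable_approximating_section:
  "(\<lambda>x. (x, approximating_section q n x)) \<in> measurable X function_structure"
proof (rule measurable_into_function_structure)
  obtain ns :: "nat list" and s :: nat where n: "from_nat n = (ns, s)" by fastforce
  fix x assume x: "x \<in> space X"
  interpret fib: locally_compact_Polish_metric "topspace (V x)" "\<lambda>u w. d ((x, u), (x, w))" "\<lambda>i. \<phi> i x"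
    by (rule fibre[OF x])
  show "x \<in> space X \<and> approximating_section q n x \<in> continuous_functions (V x) euclidean"
    using fib.approximant_in_Cfun[of q ns s] x
    unfolding approximating_section_def n metric_topology[OF x] by simp
next
  obtain ns :: "nat list" and s :: nat where n: "from_nat n = (ns, s)" by fastforce
  fix i
  have "(\<lambda>x. \<lambda>j. \<D> x j i) \<in> borel_measurable X"
    by (intro measurable_coordinatewise_then_product measurable_\<D>)
  then have "(\<lambda>x. bump_average q ns s (\<lambda>j. \<D> x j i)) \<in> borel_measurable X"
    by (rule measurable_compose[OF _ borel_measurable_continuous_onI[OF continuous_on_bump_average]])
  moreover have "approximating_section q n x (\<phi> i x) = bump_average q ns s (\<lambda>j. \<D> x j i)"
    if x: "x \<in> space X" for x
    unfolding approximating_section_def n prod.case \<D>_def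
      locally_compact_Polish_metric.approximant_def[OF fibre[OF x]]
    by (simp add: section_in[OF x])
  ultimately show "(\<lambda>x. approximating_section q n x (\<phi> i x)) \<in> borel_measurable X"
    by (simp cong: measurable_cong)
qed simp

lemma approximating_section_dense:
  assumes q: "\<And>z e. e > 0 \<Longrightarrow> \<exists>n. dist z (q n) < e" and x: "x \<in> space X"
  shows "function_field V x closure_of range (\<lambda>n. approximating_section q n x) = topspace (function_field V x)"
proof -
  interpret fib: locally_compact_Polish_metric "topspace (V x)" "\<lambda>u w. d ((x, u), (x, w))" "\<lambda>i. \<phi> i x"
    by (rule fibre[OF x])
  have "range (\<lambda>n. approximating_section q n x) =
      (\<lambda>(ns, s). fib.approximant q ns s) ` range (from_nat :: nat \<Rightarrow> nat list \<times> nat)"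
    unfolding approximating_section_def image_image by simp
  also have "\<dots> = range (\<lambda>(ns, s). fib.approximant q ns s)" by simp
  finally have eq: "range (\<lambda>n. approximating_section q n x) = range (\<lambda>(ns, s). fib.approximant q ns s)" .
  show ?thesis
    unfolding eq topspace_compact_open_topology
    using fib.approximant_closure_of[OF q] unfolding metric_topology[OF x] .
qed

lemma Polish_space_function_field: "x \<in> space X \<Longrightarrow> Polish_space (function_field V x)"
  using locally_compact_Polish_metric.Polish_space_compact_open[OF fibre] by (simp only: metric_topology)

lemma Borel_field_function_structure:
  "Borel_field_of_Polish_spaces X (function_field V) function_structure"
proof -
  obtain Q :: "complex set" where Q: "countable Q" "\<And>U. open U \<Longrightarrow> U \<noteq> {} \<Longrightarrow> \<exists>z\<in>Q. z \<in> U"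
    using countable_dense_setE by blast
  define q where "q = from_nat_into Q"
  have q: "\<exists>n. dist z (q n) < e" if e: "e > 0" for z e
  proof -
    obtain w where w: "w \<in> Q" "w \<in> ball z e" using Q(2)[of "ball z e"] e by auto
    obtain n where "q n = w" unfolding q_def using from_nat_into_surj[OF Q(1) w(1)] by blast
    then show ?thesis using w(2) by auto
  qed
  show ?thesis
    unfolding Borel_field_of_Polish_spaces_def Let_def
  proof (intro conjI exI ballI allI)
    show "space function_structure = disjoint_union (space X) (function_field V)"
      by (simp add: space_function_structure carrier_def)
    show "(\<lambda>((x, F), (y, G)). core_dist (core_indices (\<D> x)) (\<lambda>i. F (\<phi> i x)) (\<lambda>i. G (\<phi> i x)))
        \<in> borel_measurable (fibre_product function_structure function_structure)"
      by (rule measurable_function_metric)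
    show "(\<lambda>x. (x, approximating_section q n x)) \<in> measurable X function_structure" for n
      by (rule measurable_approximating_section)
    show "function_field V x closure_of range (\<lambda>n. approximating_section q n x) =
        topspace (function_field V x)" if "x \<in> space X" for x
      by (rule approximating_section_dense[OF q that])
  qed (unfold prod.case, (rule standard_borel_X Polish_space_function_field
      standard_borel_function_structure measurable_fst_function_structure function_field_metric; assumption?)+)
qed

section \<open>Algebraic operations\<close>

lemma continuous_functions_compose2:
  fixes f :: "complex \<Rightarrow> complex \<Rightarrow> complex"
  assumes f: "continuous_on UNIV (\<lambda>(z, w). f z w)"
    and F: "F \<in> continuous_functions T euclidean" and G: "G \<in> continuous_functions T euclidean"
  shows "(\<lambda>v\<in>topspace T. f (F v) (G v)) \<in> continuous_functions T euclidean"
proof -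
  have "continuous_map T euclidean F" "continuous_map T euclidean G"
    using F G unfolding continuous_functions_def by auto
  then have "continuous_map T (prod_topology euclidean euclidean) (\<lambda>v. (F v, G v))"
    by (rule continuous_map_pairedI)
  then have "continuous_map T euclidean (\<lambda>v. (F v, G v))" by simp
  moreover have "continuous_map euclidean euclidean (\<lambda>(z, w). f z w)" using f by simp
  ultimately have "continuous_map T euclidean ((\<lambda>(z, w). f z w) \<circ> (\<lambda>v. (F v, G v)))"
    by (rule continuous_map_compose)
  then have "continuous_map T euclidean (\<lambda>v\<in>topspace T. f (F v) (G v))"
    by (rule continuous_map_eq) simp
  then show ?thesis unfolding continuous_functions_def by simp
qed

text \<open>A coordinate of the result is \<open>f\<close> applied to the corresponding coordinates
  of the two arguments, so continuity of \<open>f\<close> reduces the claim to measurability of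
  coordinates.\<close>

lemma measurable_pointwise2:
  fixes f :: "complex \<Rightarrow> complex \<Rightarrow> complex"
  assumes f: "continuous_on UNIV (\<lambda>(z, w). f z w)"
  shows "(\<lambda>((x, F), (y, G)). (x, \<lambda>v\<in>topspace (V x). f (F v) (G v)))
    \<in> measurable (fibre_product function_structure function_structure) function_structure"
proof -
  let ?L = "fibre_product function_structure function_structure"
  have "(\<lambda>z. (fst (fst z), \<lambda>v\<in>topspace (V (fst (fst z))). f (snd (fst z) v) (snd (snd z) v)))
    \<in> measurable ?L function_structure"
  proof (rule measurable_into_function_structure)
    fix z assume "z \<in> space ?L"
    then have "fst (fst z) \<in> space X" "snd (fst z) \<in> continuous_functions (V (fst (fst z))) euclidean"
      "snd (snd z) \<in> continuous_functions (V (fst (fst z))) euclidean"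
      unfolding space_fibre_product space_function_structure carrier_eq by auto
    then show "fst (fst z) \<in> space X \<and> (\<lambda>v\<in>topspace (V (fst (fst z))). f (snd (fst z) v) (snd (snd z) v))
        \<in> continuous_functions (V (fst (fst z))) euclidean"
      using continuous_functions_compose2[OF f] by blast
  next
    show "(\<lambda>z. fst (fst z)) \<in> measurable ?L X"
      by (rule measurable_compose[OF measurable_fibre_product_fst measurable_fst_function_structure])
    fix i
    have "(\<lambda>z. (snd (fst z) (\<phi> i (fst (fst z))), snd (snd z) (\<phi> i (fst (snd z))))) \<in> borel_measurable ?L"
      by (intro borel_measurable_Pair measurable_compose[OF measurable_fibre_product_fst measurable_coordinate]
        measurable_compose[OF measurable_fibre_product_snd measurable_coordinate])
    from measurable_compose[OF this borel_measurable_continuous_onI[OF f]]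
    have "(\<lambda>z. f (snd (fst z) (\<phi> i (fst (fst z)))) (snd (snd z) (\<phi> i (fst (snd z))))) \<in> borel_measurable ?L"
      by simp
    then show "(\<lambda>z. (\<lambda>v\<in>topspace (V (fst (fst z))). f (snd (fst z) v) (snd (snd z) v)) (\<phi> i (fst (fst z))))
        \<in> borel_measurable ?L"
      \<comment> \<open>The base points coincide on the fibre product, and \<open>\<phi> i x\<close>
        lies in the fibre, so the restricted function takes its genuine value there.\<close>
      by (rule measurable_cong[THEN iffD1, rotated])
        (auto simp: space_fibre_product space_function_structure carrier_eq section_in)
  qed
  then show ?thesis by (simp add: case_prod_unfold)
qed

text \<open>Conjugation is treated as a binary operation that ignores its second argument, composed
  with the diagonal into the fibre product.\<close>

lemma measurable_pointwise_cnj: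
  "(\<lambda>(x, F). (x, \<lambda>v\<in>topspace (V x). cnj (F v))) \<in> measurable function_structure function_structure"
proof -
  have "(\<lambda>z. (z, z)) \<in> measurable function_structure (fibre_product function_structure function_structure)"
    by (intro measurable_into_fibre_product measurable_ident_sets refl)
  from measurable_compose[OF this measurable_pointwise2[of "\<lambda>z w. cnj z"]]
  show ?thesis by (simp add: case_prod_unfold continuous_intros)
qed

end

theorem proposition10p4:
  fixes X :: "'x measure" and V :: "'x \<Rightarrow> 'v topology" and M :: "('x \<times> 'v) measure"
  assumes "Borel_field_of_Polish_spaces X V M"
    and "\<And>x. x \<in> space X \<Longrightarrow> locally_compact_space (V x)"
  shows "(\<forall>x\<in>space X. Polish_space (function_field V x)) \<and>
    (\<exists>N. evaluation_Borel_structure X V M N \<and>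
      (\<forall>N'. evaluation_Borel_structure X V M N' \<longrightarrow> sets N' = sets N) \<and>
      Borel_field_of_Polish_spaces X (function_field V) N \<and>
      (\<lambda>((x, F), (y, G)). (x, \<lambda>v\<in>topspace (V x). F v + G v)) \<in> measurable (fibre_product N N) N \<and>
      (\<lambda>((x, F), (y, G)). (x, \<lambda>v\<in>topspace (V x). F v * G v)) \<in> measurable (fibre_product N N) N \<and>
      (\<lambda>(x, F). (x, \<lambda>v\<in>topspace (V x). cnj (F v))) \<in> measurable N N)"
proof -
  obtain d \<phi> where "locally_compact_Borel_field X V M d \<phi>"
  proof -
    obtain d :: "('x \<times> 'v) \<times> ('x \<times> 'v) \<Rightarrow> real" and \<phi> :: "nat \<Rightarrow> 'x \<Rightarrow> 'v"
      where "d \<in> borel_measurable (fibre_product M M)"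
        "\<forall>x\<in>space X. Metric_space (topspace (V x)) (\<lambda>u w. d ((x, u), (x, w))) \<and>
            Metric_space.mcomplete (topspace (V x)) (\<lambda>u w. d ((x, u), (x, w))) \<and>
            Metric_space.mtopology (topspace (V x)) (\<lambda>u w. d ((x, u), (x, w))) = V x"
        "\<forall>n. (\<lambda>x. (x, \<phi> n x)) \<in> measurable X M"
        "\<forall>x\<in>space X. V x closure_of range (\<lambda>n. \<phi> n x) = topspace (V x)"
      using assms(1) unfolding Borel_field_of_Polish_spaces_def Let_def by blast
    then have "locally_compact_Borel_field X V M d \<phi>"
      using assms unfolding Borel_field_of_Polish_spaces_def locally_compact_Borel_field_def by simp
    then show ?thesis by (rule that)
  qed
  then interpret locally_compact_Borel_field X V M d \<phi> .
  have "continuous_on UNIV (\<lambda>(z, w). z + w :: complex)" "continuous_on UNIV (\<lambda>(z, w). z * w :: complex)"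
    by (auto simp: case_prod_unfold intro!: continuous_intros)
  from this[THEN measurable_pointwise2] show ?thesis
    by (intro conjI ballI exI[of _ function_structure] allI impI)
      ((rule Polish_space_function_field evaluation_Borel_structure_function_structure
        sets_evaluation_Borel_structure Borel_field_function_structure measurable_pointwise_cnj; assumption)
       | assumption)+
qed

end
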